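(* Let $G$ be a LEF group with a fixed finite generating set $S$ and a LEF approximation $\theta_n:G\to G_n$ ($n\in\mathbb{N}$). Assume that the LEF approximation $\theta_n$ is essential and by simple groups. Let $\Gamma=\bigotimes_n G_n$ be the associated diagonal product and $U=\bigoplus_n G_n\lhd\Gamma$. Then the space of characters of $\Gamma$ is $$\mathrm{Ch}(\Gamma)\;\cong\;\Big\{(\varphi,\psi)\in\Big(\prod_n\mathrm{Ch}(G_n)\Big)\times\mathrm{Tr}(G)\;:\;\psi\text{ is a compatible character for }\varphi\Big\}.$$ That is, there is a bijection from $\mathrm{Ch}(\Gamma)$ to the set on the right, whose first coordinate is the restriction $\zeta\mapsto\zeta|_U\in\mathrm{Ch}(U)\cong\prod_n\mathrm{Ch}(G_n)$.
   Context: Traces and characters. A trace on a countable group $G$ is a positive-definite, conjugation-invariant function $\varphi:G\to\mathbb{C}$ with $\varphi(e)=1$. The set $\mathrm{Tr}(G)$ of traces is convex and compact for pointwise convergence; its extreme points are called characters and form the set $\mathrm{Ch}(G)$. For finite groups these are the normalized irreducible characters. For a direct sum $U=\bigoplus_n G_n$ there is a bijection $\prod_n\mathrm{Ch}(G_n)\cong\mathrm{Ch}(U)$ sending $(\varphi_n)$ to $\otimes_n\varphi_n:(g_n)\mapsto\prod_n\varphi_n(g_n)$; these sets are identified. LEF approximations. A LEF approximation of a countable group $G$ is a sequence of maps (not necessarily homomorphisms) $\theta_n:G\to G_n$ into finite groups $G_n$ such that (i) for all $g,h\in G$, $\theta_n(gh)=\theta_n(g)\theta_n(h)$ for all sufficiently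 large $n$, and (ii) for every $g\neq e$, $\theta_n(g)\ne e$ for all sufficiently large $n$. $G$ is LEF if it admits a LEF approximation. Given a finite generating set $S$ of $G$, the approximation is essential and by simple groups if: the $G_n$ are simple and pairwise non-isomorphic; for every $n$ the restriction $\theta_n|_S$ does not extend to a homomorphism $G\to G_n$; and for every $n$ the set $\theta_n(S)$ generates $G_n$. Diagonal product. $\Gamma=\bigotimes_nG_n$ is the subgroup of $\prod_nG_n$ generated by the elements $\gamma_s=(\theta_n(s))_n$, $s\in S$. When $G$ is a group with finite generating set $S$ and $\theta_n:G\to G_n$ is a LEF approximation that is essential and by simple groups, there is a well-defined surjective homomorphism $t:\Gamma\to G$ (the tail map) with $t(\gamma_s)=s$ for $s\in S$, and $\ker t=\bigoplus_nG_n=U$, which is contained in $\Gamma$. Compatibility. Let $\varphi=\otimes_i\varphi_i\in\mathrm{Ch}(U)$, $\varphi_i\in\mathrm{Ch}(G_i)$. An element $\tau\in G$ is null for $\varphi$ if every $g=(g_i)\in\Gamma$ with $t(g)=\tau$ satisfies $\prod_{i=1}^\infty|\varphi_i(g_i)|=0$ (limit of the non-increasing partial products). A trace $\psi\in\mathrm{Tr}(G)$ is compatible with $\varphi$ if $\psi(\tau)=0$ for every $\tau\in G$ that is null for $\varphi$. A compatible character for $\varphi$ is a trace $\psi\in\mathrm{Tr}(G)$ compatible with $\varphi$ which is not a non-trivial convex combination of two traces on $G$ both compatible with $\varphi$ (i.e. an extreme point of the set of traces compatible with $\varphi$). *)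

theory Defs
  imports "HOL-Algebra.Algebra" "HOL-Analysis.Analysis"
begin

section \<open>Traces and characters\<close>

text \<open>Functions on a group are required to be extensional (\<open>undefined\<close> outside the carrier), so
  that equality of two of them is equality on the carrier.\<close>

definition positive_definite :: "('a, 'm) monoid_scheme \<Rightarrow> ('a \<Rightarrow> complex) \<Rightarrow> bool" where
  "positive_definite G f \<longleftrightarrow>
     (\<forall>F c. finite F \<and> F \<subseteq> carrier G \<longrightarrow>
        (\<Sum>g\<in>F. \<Sum>h\<in>F. c g * cnj (c h) * f (inv\<^bsub>G\<^esub> h \<otimes>\<^bsub>G\<^esub> g)) \<in> \<real>\<^sub>\<ge>\<^sub>0)"

definition traces :: "('a, 'm) monoid_scheme \<Rightarrow> ('a \<Rightarrow> complex) set" where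
  "traces G = {f \<in> extensional (carrier G).
     positive_definite G f \<and>
     (\<forall>g\<in>carrier G. \<forall>x\<in>carrier G. f (x \<otimes>\<^bsub>G\<^esub> g \<otimes>\<^bsub>G\<^esub> inv\<^bsub>G\<^esub> x) = f g) \<and>
     f \<one>\<^bsub>G\<^esub> = 1}"

text \<open>The library's \<^const>\<open>extreme_point_of\<close> needs a type of class \<^class>\<open>real_vector\<close>, which
  the function type is not.\<close>

definition extreme_functions ::
    "('a, 'm) monoid_scheme \<Rightarrow> ('a \<Rightarrow> complex) set \<Rightarrow> ('a \<Rightarrow> complex) set" where
  "extreme_functions G K = {f \<in> K. \<not> (\<exists>\<alpha>\<in>K. \<exists>\<beta>\<in>K. \<exists>u::real. \<alpha> \<noteq> \<beta> \<and> 0 < u \<and> u < 1 \<and>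
     (\<forall>g\<in>carrier G. f g = of_real u * \<alpha> g + of_real (1 - u) * \<beta> g))}"

definition characters :: "('a, 'm) monoid_scheme \<Rightarrow> ('a \<Rightarrow> complex) set" where
  "characters G = extreme_functions G (traces G)"

section \<open>LEF approximations\<close>

definition lef_approximation ::
    "('a, 'm) monoid_scheme \<Rightarrow> (nat \<Rightarrow> ('b, 'k) monoid_scheme) \<Rightarrow> (nat \<Rightarrow> 'a \<Rightarrow> 'b) \<Rightarrow> bool" where
  "lef_approximation G H \<theta> \<longleftrightarrow>
     (\<forall>n. group (H n) \<and> finite (carrier (H n)) \<and> \<theta> n \<in> carrier G \<rightarrow> carrier (H n)) \<and>
     (\<forall>g\<in>carrier G. \<forall>h\<in>carrier G.
        \<forall>\<^sub>F n in sequentially. \<theta> n (g \<otimes>\<^bsub>G\<^esub> h) = \<theta> n g \<otimes>\<^bsub>H n\<^esub> \<theta> n h) \<and>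
     (\<forall>g\<in>carrier G. g \<noteq> \<one>\<^bsub>G\<^esub> \<longrightarrow> (\<forall>\<^sub>F n in sequentially. \<theta> n g \<noteq> \<one>\<^bsub>H n\<^esub>))"

definition essential_by_simple_groups ::
    "('a, 'm) monoid_scheme \<Rightarrow> 'a set \<Rightarrow> (nat \<Rightarrow> ('b, 'k) monoid_scheme) \<Rightarrow> (nat \<Rightarrow> 'a \<Rightarrow> 'b) \<Rightarrow> bool"
  where
  "essential_by_simple_groups G S H \<theta> \<longleftrightarrow>
     (\<forall>n. simple_group (H n)) \<and>
     (\<forall>m n. m \<noteq> n \<longrightarrow> \<not> is_iso (H m) (H n)) \<and>
     (\<forall>n. \<not> (\<exists>f \<in> hom G (H n). \<forall>s\<in>S. f s = \<theta> n s)) \<and>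
     (\<forall>n. generate (H n) (\<theta> n ` S) = carrier (H n))"

section \<open>The diagonal product and its tail map\<close>

definition diagonal_product ::
    "'a set \<Rightarrow> (nat \<Rightarrow> ('b, 'k) monoid_scheme) \<Rightarrow> (nat \<Rightarrow> 'a \<Rightarrow> 'b) \<Rightarrow> (nat \<Rightarrow> 'b) monoid" where
  "diagonal_product S H \<theta> =
     subgroup_generated (product_group UNIV H) ((\<lambda>s. (\<lambda>n. \<theta> n s)) ` S)"

text \<open>For an essential LEF approximation by simple groups such a homomorphism exists; it is unique
  because it is prescribed on generators and extensional.\<close>

definition tail_map ::
    "('a, 'm) monoid_scheme \<Rightarrow> 'a set \<Rightarrow> (nat \<Rightarrow> ('b, 'k) monoid_scheme) \<Rightarrow> (nat \<Rightarrow> 'a \<Rightarrow> 'b)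
     \<Rightarrow> (nat \<Rightarrow> 'b) \<Rightarrow> 'a" where
  "tail_map G S H \<theta> = (THE t.
     t \<in> hom (diagonal_product S H \<theta>) G \<inter> extensional (carrier (diagonal_product S H \<theta>)) \<and>
     (\<forall>s\<in>S. t (\<lambda>n. \<theta> n s) = s))"

text \<open>Elements of the direct sum have finite support and \<open>\<phi> n \<one> = 1\<close>, so the product over all
  indices is the finite product over the support.\<close>

definition tensor_character ::
    "(nat \<Rightarrow> ('b, 'k) monoid_scheme) \<Rightarrow> (nat \<Rightarrow> 'b \<Rightarrow> complex) \<Rightarrow> (nat \<Rightarrow> 'b) \<Rightarrow> complex" where
  "tensor_character H \<phi> =
     (\<lambda>g\<in>carrier (sum_group UNIV H). \<Prod>n | g n \<noteq> \<one>\<^bsub>H n\<^esub>. \<phi> n (g n))"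

section \<open>Compatibility\<close>

definition null_element ::
    "('a, 'm) monoid_scheme \<Rightarrow> 'a set \<Rightarrow> (nat \<Rightarrow> ('b, 'k) monoid_scheme) \<Rightarrow> (nat \<Rightarrow> 'a \<Rightarrow> 'b)
     \<Rightarrow> (nat \<Rightarrow> 'b \<Rightarrow> complex) \<Rightarrow> 'a \<Rightarrow> bool" where
  "null_element G S H \<theta> \<phi> \<tau> \<longleftrightarrow>
     (\<forall>g\<in>carrier (diagonal_product S H \<theta>). tail_map G S H \<theta> g = \<tau> \<longrightarrow>
        (\<lambda>N. \<Prod>i<N. cmod (\<phi> i (g i))) \<longlonglongrightarrow> 0)"

definition compatible_traces ::
    "('a, 'm) monoid_scheme \<Rightarrow> 'a set \<Rightarrow> (nat \<Rightarrow> ('b, 'k) monoid_scheme) \<Rightarrow> (nat \<Rightarrow> 'a \<Rightarrow> 'b)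
     \<Rightarrow> (nat \<Rightarrow> 'b \<Rightarrow> complex) \<Rightarrow> ('a \<Rightarrow> complex) set" where
  "compatible_traces G S H \<theta> \<phi> =
     {\<psi> \<in> traces G. \<forall>\<tau>\<in>carrier G. null_element G S H \<theta> \<phi> \<tau> \<longrightarrow> \<psi> \<tau> = 0}"

definition compatible_characters ::
    "('a, 'm) monoid_scheme \<Rightarrow> 'a set \<Rightarrow> (nat \<Rightarrow> ('b, 'k) monoid_scheme) \<Rightarrow> (nat \<Rightarrow> 'a \<Rightarrow> 'b)
     \<Rightarrow> (nat \<Rightarrow> 'b \<Rightarrow> complex) \<Rightarrow> ('a \<Rightarrow> complex) set" where
  "compatible_characters G S H \<theta> \<phi> = extreme_functions G (compatible_traces G S H \<theta> \<phi>)"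

end

theory Submission
  imports Defs "HOL-Complex_Analysis.Great_Picard"
begin

text \<open>An extreme trace \<open>\<zeta>\<close> is multiplicative against class sums of finite conjugacy classes, since
  these are central in the group algebra. Applied to the coordinate subgroups of \<open>\<Gamma>\<close>, this makes
  the restrictions \<open>\<phi> n\<close> of \<open>\<zeta>\<close> to \<open>H n\<close> characters and gives
  \<open>\<zeta> g = (\<Prod>i<N. \<phi> i (g i)) * \<zeta> (tail N g)\<close>, where \<open>tail N g\<close> replaces the first \<open>N\<close> coordinates by the
  identity; the same identity holds for every trace whose restrictions \<open>\<phi> n\<close> are extreme, because it
  only says that certain vectors of the GNS representation vanish. A pointwise limit \<open>\<Phi>\<close> of a
  subsequence of the partial products of \<open>\<Otimes>\<^sub>n \<phi> n\<close> is a trace on \<open>\<Gamma>\<close> with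
  \<open>\<bar>\<Phi> g\<bar> = (\<Prod>i. \<bar>\<phi> i (g i)\<bar>)\<close>, and \<open>\<psi> \<mapsto> \<Phi> * (\<psi> \<circ> t)\<close> is an affine bijection from the traces
  compatible with \<open>\<phi>\<close> onto the traces on \<open>\<Gamma>\<close> that extend \<open>\<Otimes>\<^sub>n \<phi> n\<close>. Positivity of products and of
  the inverse construction comes from Schur's product theorem. As each \<open>\<phi> n\<close> is extreme, the traces
  extending \<open>\<Otimes>\<^sub>n \<phi> n\<close> form a face, so extreme points correspond to extreme points.\<close>

section \<open>Positive kernels\<close>

text \<open>Only the moduli of the partial products converge; their phases may rotate forever. So no
  extension of the tensor product to \<open>\<Gamma>\<close> is canonical and the correspondence
  depends on the choice of \<open>\<Phi>\<close>, whereas nullity, a statement about moduli, does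
  not. Cutting off \<open>N\<close> coordinates removes the same factor from every extension, so the
  quotient of an extension by \<open>\<Phi>\<close> is constant along tails and depends on
  \<open>t g\<close> alone. It is undetermined exactly at the null elements, which is why
  \<open>\<psi>\<close> must vanish there. Division does not preserve positive definiteness, but
  multiplication by \<open>cnj \<Phi>\<close> does, and off the null elements the two agree in the
  limit along tails. The GNS space stays a picture: a null vector is a finite combination of group
  elements of square length zero, and Cauchy-Schwarz makes it orthogonal to everything.\<close>

lemma cnj_mem_nonneg_Reals_iff: "cnj z \<in> \<real>\<^sub>\<ge>\<^sub>0 \<longleftrightarrow> z \<in> \<real>\<^sub>\<ge>\<^sub>0"
  by (simp add: complex_nonneg_Reals_iff)

lemma mult_cnj_mem_nonneg_Reals: "z * cnj z \<in> \<real>\<^sub>\<ge>\<^sub>0"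
  by (simp add: complex_nonneg_Reals_iff)

text \<open>The index set is arbitrary rather than a group, so that vectors can be repeated,
  translated and combined before positivity is used.\<close>

definition pos_kernel :: "'i set \<Rightarrow> ('i \<Rightarrow> 'i \<Rightarrow> complex) \<Rightarrow> bool" where
  "pos_kernel A k \<longleftrightarrow>
     (\<forall>F c. finite F \<and> F \<subseteq> A \<longrightarrow> (\<Sum>i\<in>F. \<Sum>j\<in>F. c i * cnj (c j) * k i j) \<in> \<real>\<^sub>\<ge>\<^sub>0)"

lemma pos_kernelD:
  "pos_kernel A k \<Longrightarrow> finite F \<Longrightarrow> F \<subseteq> A \<Longrightarrow> (\<Sum>i\<in>F. \<Sum>j\<in>F. c i * cnj (c j) * k i j) \<in> \<real>\<^sub>\<ge>\<^sub>0"
  unfolding pos_kernel_def by blast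

lemma pos_kernel_subset: "pos_kernel A k \<Longrightarrow> B \<subseteq> A \<Longrightarrow> pos_kernel B k"
  unfolding pos_kernel_def by blast

lemma pos_kernel_cong:
  assumes "\<And>i j. i \<in> A \<Longrightarrow> j \<in> A \<Longrightarrow> k i j = l i j"
  shows "pos_kernel A k \<longleftrightarrow> pos_kernel A l"
proof -
  have "(\<Sum>i\<in>F. \<Sum>j\<in>F. c i * cnj (c j) * k i j) = (\<Sum>i\<in>F. \<Sum>j\<in>F. c i * cnj (c j) * l i j)"
    if "F \<subseteq> A" for F c
    using that assms by (intro sum.cong refl) (auto simp: subset_iff)
  then show ?thesis unfolding pos_kernel_def by (metis (no_types, lifting))
qed

text \<open>Coefficients on indices with the same image are added up. Any map is allowed, in
  particular the section used in \<open>trace_descend\<close>.\<close>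

lemma pos_kernel_pullback:
  assumes k: "pos_kernel B k" and f: "f \<in> A \<rightarrow> B"
  shows "pos_kernel A (\<lambda>i j. k (f i) (f j))"
  unfolding pos_kernel_def
proof (intro allI impI)
  fix F :: "'b set" and c :: "'b \<Rightarrow> complex"
  assume F: "finite F \<and> F \<subseteq> A"
  define d where "d b = (\<Sum>i | i \<in> F \<and> f i = b. c i)" for b
  have group: "(\<Sum>i\<in>F. e i * w (f i)) = (\<Sum>b\<in>f ` F. (\<Sum>i | i \<in> F \<and> f i = b. e i) * w b)"
    for e w :: "_ \<Rightarrow> complex"
    by (subst sum.image_gen[of F _ f]) (use F in \<open>auto simp: sum_distrib_right intro!: sum.cong\<close>)
  have "(\<Sum>i\<in>F. \<Sum>j\<in>F. c i * cnj (c j) * k (f i) (f j))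
      = (\<Sum>i\<in>F. c i * (\<Sum>j\<in>F. cnj (c j) * k (f i) (f j)))"
    by (simp add: sum_distrib_left mult.assoc)
  also have "\<dots> = (\<Sum>i\<in>F. c i * (\<Sum>b\<in>f ` F. cnj (d b) * k (f i) b))"
    using group[of "\<lambda>j. cnj (c j)" "k (f _)"] by (simp add: d_def)
  also have "\<dots> = (\<Sum>a\<in>f ` F. d a * (\<Sum>b\<in>f ` F. cnj (d b) * k a b))"
    by (simp add: group[of c "\<lambda>a. \<Sum>b\<in>f ` F. cnj (d b) * k a b"] flip: d_def)
  also have "\<dots> = (\<Sum>a\<in>f ` F. \<Sum>b\<in>f ` F. d a * cnj (d b) * k a b)"
    by (simp add: sum_distrib_left mult.assoc)
  also have "\<dots> \<in> \<real>\<^sub>\<ge>\<^sub>0"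
    using F f by (intro pos_kernelD[OF k]) auto
  finally show "(\<Sum>i\<in>F. \<Sum>j\<in>F. c i * cnj (c j) * k (f i) (f j)) \<in> \<real>\<^sub>\<ge>\<^sub>0" .
qed

text \<open>The kernel of the vectors \<open>\<Sum>p\<in>P. a p i \<cdot> e (T p i)\<close> when \<open>k\<close> is the kernel of the vectors \<open>e\<close>.\<close>

lemma pos_kernel_combine:
  fixes a :: "'p \<Rightarrow> 'i \<Rightarrow> complex"
  assumes k: "pos_kernel B k" and P: "finite P" and T: "\<And>p i. p \<in> P \<Longrightarrow> i \<in> A \<Longrightarrow> T p i \<in> B"
  shows "pos_kernel A (\<lambda>i j. \<Sum>p\<in>P. \<Sum>q\<in>P. a p i * cnj (a q j) * k (T p i) (T q j))"
  unfolding pos_kernel_def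
proof (intro allI impI)
  fix F :: "'i set" and c :: "'i \<Rightarrow> complex"
  assume F: "finite F \<and> F \<subseteq> A"
  have k': "pos_kernel (A \<times> P) (\<lambda>x y. k (T (snd x) (fst x)) (T (snd y) (fst y)))"
    by (rule pos_kernel_pullback[OF k, where f = "\<lambda>x. T (snd x) (fst x)"]) (use T in auto)
  have "(\<Sum>i\<in>F. \<Sum>j\<in>F. c i * cnj (c j) *
           (\<Sum>p\<in>P. \<Sum>q\<in>P. a p i * cnj (a q j) * k (T p i) (T q j)))
      = (\<Sum>i\<in>F. \<Sum>j\<in>F. \<Sum>p\<in>P. \<Sum>q\<in>P. (c i * a p i) * cnj (c j * a q j) * k (T p i) (T q j))"
    by (simp add: sum_distrib_left mult_ac)
  also have "\<dots> = (\<Sum>i\<in>F. \<Sum>p\<in>P. \<Sum>j\<in>F. \<Sum>q\<in>P. (c i * a p i) * cnj (c j * a q j) * k (T p i) (T q j))"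
    by (intro sum.cong refl, rule sum.swap)
  also have "\<dots> = (\<Sum>x\<in>F \<times> P. \<Sum>y\<in>F \<times> P. (c (fst x) * a (snd x) (fst x)) *
      cnj (c (fst y) * a (snd y) (fst y)) * k (T (snd x) (fst x)) (T (snd y) (fst y)))"
    by (simp add: sum.cartesian_product')
  also have "\<dots> \<in> \<real>\<^sub>\<ge>\<^sub>0"
    by (rule pos_kernelD[OF k', of "F \<times> P" "\<lambda>x. c (fst x) * a (snd x) (fst x)"]) (use F P in auto)
  finally show "(\<Sum>i\<in>F. \<Sum>j\<in>F. c i * cnj (c j) *
           (\<Sum>p\<in>P. \<Sum>q\<in>P. a p i * cnj (a q j) * k (T p i) (T q j))) \<in> \<real>\<^sub>\<ge>\<^sub>0" .
qed

lemma pos_kernel_add: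
  assumes "pos_kernel A k" "pos_kernel A l"
  shows "pos_kernel A (\<lambda>i j. k i j + l i j)"
  using assms unfolding pos_kernel_def
  by (simp add: distrib_left sum.distrib)

lemma pos_kernel_zero: "pos_kernel A (\<lambda>i j. 0)"
  by (simp add: pos_kernel_def)

lemma pos_kernel_sum:
  "(\<And>p. p \<in> P \<Longrightarrow> pos_kernel A (k p)) \<Longrightarrow> pos_kernel A (\<lambda>i j. \<Sum>p\<in>P. k p i j)"
  by (induction P rule: infinite_finite_induct) (simp_all add: pos_kernel_add pos_kernel_zero)

lemma pos_kernel_scale:
  assumes "pos_kernel A k" "r \<in> \<real>\<^sub>\<ge>\<^sub>0"
  shows "pos_kernel A (\<lambda>i j. r * k i j)"
  unfolding pos_kernel_def
proof (intro allI impI)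
  fix F c assume F: "finite F \<and> F \<subseteq> A"
  have "(\<Sum>i\<in>F. \<Sum>j\<in>F. c i * cnj (c j) * (r * k i j)) = r * (\<Sum>i\<in>F. \<Sum>j\<in>F. c i * cnj (c j) * k i j)"
    by (simp add: sum_distrib_left mult_ac)
  then show "(\<Sum>i\<in>F. \<Sum>j\<in>F. c i * cnj (c j) * (r * k i j)) \<in> \<real>\<^sub>\<ge>\<^sub>0"
    using pos_kernelD[OF assms(1), of F c] assms(2) F by simp
qed

lemma pos_kernel_limit:
  assumes "\<And>n. pos_kernel A (k n)"
    and "\<And>i j. i \<in> A \<Longrightarrow> j \<in> A \<Longrightarrow> (\<lambda>n::nat. k n i j) \<longlonglongrightarrow> l i j"
  shows "pos_kernel A l"
  unfolding pos_kernel_def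
proof (intro allI impI)
  fix F c assume F: "finite F \<and> F \<subseteq> A"
  have "(\<lambda>n. \<Sum>i\<in>F. \<Sum>j\<in>F. c i * cnj (c j) * k n i j) \<longlonglongrightarrow> (\<Sum>i\<in>F. \<Sum>j\<in>F. c i * cnj (c j) * l i j)"
    using F by (intro tendsto_sum tendsto_mult tendsto_const assms(2)) auto
  then show "(\<Sum>i\<in>F. \<Sum>j\<in>F. c i * cnj (c j) * l i j) \<in> \<real>\<^sub>\<ge>\<^sub>0"
    by (rule closed_sequentially[OF closed_nonneg_Reals_complex, rotated])
       (use assms(1) F in \<open>auto intro: pos_kernelD\<close>)
qed

section \<open>Symmetry and Cauchy-Schwarz\<close>

lemma pos_kernel_pair:
  assumes "pos_kernel A k" "i \<in> A" "j \<in> A"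
  shows "a * cnj a * k i i + a * cnj b * k i j + b * cnj a * k j i + b * cnj b * k j j \<in> \<real>\<^sub>\<ge>\<^sub>0"
proof -
  \<comment> \<open>Booleans name the two vectors, so the case \<open>i = j\<close> needs no
    separate treatment.\<close>
  have "pos_kernel (UNIV :: bool set) (\<lambda>s t. k (if s then i else j) (if t then i else j))"
    by (rule pos_kernel_pullback[OF assms(1), where f = "\<lambda>s. if s then i else j"]) (use assms in auto)
  from pos_kernelD[OF this, of UNIV "\<lambda>s. if s then a else b"]
  show ?thesis by (simp add: UNIV_bool algebra_simps)
qed

lemma pos_kernel_diag: "pos_kernel A k \<Longrightarrow> i \<in> A \<Longrightarrow> k i i \<in> \<real>\<^sub>\<ge>\<^sub>0"
  using pos_kernel_pair[of A k i i 1 0] by simp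

text \<open>Coefficients \<open>1, 1\<close> force the imaginary parts of \<open>k i j\<close> and
  \<open>k j i\<close> to cancel; coefficients \<open>1, \<i>\<close> force the real parts to
  agree.\<close>

lemma pos_kernel_hermitian:
  assumes "pos_kernel A k" "i \<in> A" "j \<in> A"
  shows "k j i = cnj (k i j)"
  using pos_kernel_pair[OF assms, of 1 1] pos_kernel_pair[OF assms, of 1 \<i>]
    pos_kernel_diag[OF assms(1,2)] pos_kernel_diag[OF assms(1,3)]
  by (simp add: complex_nonneg_Reals_iff complex_eq_iff)

lemma pos_kernel_Cauchy_Schwarz:
  assumes "pos_kernel A k" "i \<in> A" "j \<in> A"
  shows "(cmod (k i j))\<^sup>2 \<le> Re (k i i) * Re (k j j)"
proof -
  define p where "p = Re (k i i)"
  define q where "q = Re (k j j)"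
  define z where "z = k i j"
  have ii: "k i i = of_real p" "p \<ge> 0" and jj: "k j j = of_real q" "q \<ge> 0"
    using pos_kernel_diag[OF assms(1,2)] pos_kernel_diag[OF assms(1,3)]
    by (auto simp: p_def q_def complex_nonneg_Reals_iff complex_eq_iff)
  have ji: "k j i = cnj z"
    unfolding z_def by (rule pos_kernel_hermitian[OF assms])
  \<comment> \<open>The square length of \<open>- t * cnj z\<close> times vector \<open>i\<close>
    plus \<open>s\<close> times vector \<open>j\<close>; the factor \<open>cnj z\<close> makes the
    cross terms real.\<close>
  have *: "t\<^sup>2 * (cmod z)\<^sup>2 * p - 2 * t * s * (cmod z)\<^sup>2 + s\<^sup>2 * q \<ge> 0" for t s :: real
  proof -
    have eq: "(- of_real t * cnj z) * cnj (- of_real t * cnj z) * k i i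
        + (- of_real t * cnj z) * cnj (of_real s) * k i j
        + of_real s * cnj (- of_real t * cnj z) * k j i + of_real s * cnj (of_real s) * k j j
        = of_real (t\<^sup>2 * (cmod z)\<^sup>2 * p - 2 * t * s * (cmod z)\<^sup>2 + s\<^sup>2 * q)"
    proof -
      have zz: "z * cnj z = (of_real (cmod z))\<^sup>2"
        using complex_norm_square[of z] by simp
      show ?thesis
        unfolding ii jj ji z_def[symmetric] of_real_add of_real_diff of_real_mult of_real_power
          zz[symmetric]
        by (simp add: power2_eq_square algebra_simps)
    qed
    then show ?thesis
      using pos_kernel_pair[OF assms, of "- of_real t * cnj z" "of_real s"]
      by (simp only: eq nonneg_Reals_of_real_iff)
  qed
  show ?thesis
  proof (cases "p = 0")
    case False
    with ii have "p > 0" by simp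
    \<comment> \<open>\<open>t / s = 1 / p\<close> is where the quadratic in \<open>t\<close> is
      smallest.\<close>
    from *[of 1 p] have "p * (p * q - (cmod z)\<^sup>2) \<ge> 0"
      by (simp add: algebra_simps power2_eq_square)
    with \<open>p > 0\<close> show ?thesis
      by (simp add: zero_le_mult_iff p_def q_def z_def)
  next
    case True
    have "(cmod z)\<^sup>2 = 0"
    proof (rule ccontr)
      define nz where "nz = (cmod z)\<^sup>2"
      assume "(cmod z)\<^sup>2 \<noteq> 0"
      then have "nz > 0" by (simp add: nz_def)
      \<comment> \<open>With \<open>p = 0\<close> the form is affine in \<open>t\<close> and stays
        nonnegative only if its slope vanishes.\<close>
      have "2 * t * nz \<le> q" for t
        using *[of t 1] True by (simp add: nz_def)
      from this[of "(q + 1) / (2 * nz)"] \<open>nz > 0\<close> show False by simp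
    qed
    then show ?thesis using True by (simp add: z_def p_def)
  qed
qed

text \<open>A vector of length zero lies in the radical of the form: this is Cauchy-Schwarz for the
  two-vector kernel of \<open>v\<close> and the basis vector at \<open>y\<close>.\<close>

lemma pos_kernel_null:
  assumes k: "pos_kernel A k" and I: "finite I" "I \<subseteq> A" and y: "y \<in> A"
    and null: "(\<Sum>i\<in>I. \<Sum>j\<in>I. v i * cnj (v j) * k i j) = 0"
  shows "(\<Sum>i\<in>I. v i * k i y) = 0"
proof -
  define P where "P = insert y I"
  \<comment> \<open>\<open>True\<close> selects the null vector and \<open>False\<close> the basis
    vector at \<open>y\<close>, both as coefficients over \<open>insert y I\<close>;
    \<open>y\<close> may itself lie in \<open>I\<close>.\<close>
  define a where "a p s = (if s then (if p \<in> I then v p else 0) else (if p = y then 1 else 0))"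
    for p and s :: bool
  define K where "K s t = (\<Sum>p\<in>P. \<Sum>q\<in>P. a p s * cnj (a q t) * k p q)" for s t
  have P: "finite P" "P \<subseteq> A" "I \<subseteq> P" "y \<in> P" using I y by (auto simp: P_def)
  have K: "pos_kernel UNIV K"
    unfolding K_def by (rule pos_kernel_combine[OF k]) (use P in auto)
  have restr: "(\<Sum>p\<in>P. a p True * w p) = (\<Sum>p\<in>I. v p * w p)"
      "(\<Sum>p\<in>P. cnj (a p True) * w p) = (\<Sum>p\<in>I. cnj (v p) * w p)" for w
    by (rule sum.mono_neutral_cong_right; use P in \<open>auto simp: a_def\<close>)+
  have "K True True = (\<Sum>p\<in>P. a p True * (\<Sum>q\<in>P. cnj (a q True) * k p q))"
    by (simp add: K_def sum_distrib_left mult.assoc)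
  also have "\<dots> = (\<Sum>p\<in>I. v p * (\<Sum>q\<in>I. cnj (v q) * k p q))"
    by (simp add: restr)
  finally have "K True True = 0"
    using null by (simp add: sum_distrib_left mult.assoc)
  with pos_kernel_Cauchy_Schwarz[OF K, of True False] have "K True False = 0" by simp
  moreover have "K True False = (\<Sum>p\<in>P. a p True * (\<Sum>q\<in>P. cnj (a q False) * k p q))"
    by (simp add: K_def sum_distrib_left mult.assoc)
  moreover have "(\<Sum>q\<in>P. cnj (a q False) * k p q) = k p y" for p
    by (subst sum.mono_neutral_cong_right[of P "{y}" _ "\<lambda>q. k p q"]) (use P in \<open>auto simp: a_def\<close>)
  ultimately show ?thesis by (simp add: restr)
qed

text \<open>Schur's product theorem: subtracting from \<open>k\<close> the rank-one kernel \<open>k i x * k x j / k x x\<close>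
  makes row and column \<open>x\<close> vanish.\<close>

lemma pos_kernel_mult_finite:
  assumes "finite F" "pos_kernel F k" "pos_kernel F l"
  shows "(\<Sum>i\<in>F. \<Sum>j\<in>F. c i * cnj (c j) * (k i j * l i j)) \<in> \<real>\<^sub>\<ge>\<^sub>0"
  using assms
proof (induction F arbitrary: k rule: finite_induct)
  case empty
  then show ?case by simp
next
  case (insert x F)
  let ?F = "insert x F"
  define r where "r = Re (k x x)"
  have r: "k x x = of_real r" "r \<ge> 0"
    using pos_kernel_diag[OF insert.prems(1), of x]
    by (auto simp: r_def complex_nonneg_Reals_iff complex_eq_iff)
  have herm: "k x j = cnj (k j x)" if "j \<in> ?F" for j
    using pos_kernel_hermitian[OF insert.prems(1) that] by simp
  define k' where "k' i j = k i j - k i x * k x j / k x x" for i j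
  have row: "k' x j = 0" "k' j x = 0" if "j \<in> ?F" for j
  proof -
    have "k j x = 0" if "k x x = 0"
      using pos_kernel_Cauchy_Schwarz[OF insert.prems(1) \<open>j \<in> ?F\<close>, of x] that by simp
    then show "k' x j = 0" "k' j x = 0"
      using herm[OF that] by (auto simp: k'_def)
  qed
  have "pos_kernel ?F k'"
  proof -
    \<comment> \<open>\<open>k'\<close> is the kernel of the vectors \<open>i\<close> minus their
      projections to the vector \<open>x\<close>. If \<open>k x x = 0\<close>, the division yields 0
      and \<open>k'\<close> is \<open>k\<close> itself.\<close>
    define a where "a p i = (if p then 1 else - k i x / k x x)" for p :: bool and i
    have "pos_kernel ?F (\<lambda>i j. \<Sum>p\<in>UNIV. \<Sum>q\<in>UNIV. a p i * cnj (a q j) *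
            k (if p then i else x) (if q then j else x))"
      by (rule pos_kernel_combine[OF insert.prems(1), where T = "\<lambda>p i. if p then i else x"]) auto
    moreover have "(\<Sum>p\<in>UNIV. \<Sum>q\<in>UNIV. a p i * cnj (a q j) *
            k (if p then i else x) (if q then j else x)) = k' i j" if "i \<in> ?F" "j \<in> ?F" for i j
      using r herm[OF that(2)]
      by (cases "r = 0") (simp_all add: UNIV_bool a_def k'_def divide_simps algebra_simps)
    ultimately show ?thesis
      by (subst (asm) pos_kernel_cong) auto
  qed
  then have "(\<Sum>i\<in>F. \<Sum>j\<in>F. c i * cnj (c j) * (k' i j * l i j)) \<in> \<real>\<^sub>\<ge>\<^sub>0"
    by (intro insert.IH) (auto intro: pos_kernel_subset insert.prems)
  moreover have "(\<Sum>i\<in>?F. \<Sum>j\<in>?F. c i * cnj (c j) * (k' i j * l i j))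
      = (\<Sum>i\<in>F. \<Sum>j\<in>F. c i * cnj (c j) * (k' i j * l i j))"
    using insert.hyps row by simp
  moreover have "(\<Sum>i\<in>?F. \<Sum>j\<in>?F. c i * cnj (c j) * (k i x * k x j / k x x * l i j)) \<in> \<real>\<^sub>\<ge>\<^sub>0"
  proof -
    \<comment> \<open>The rank-one factor is absorbed into the coefficients, which leaves a
      nonnegative multiple of the form of \<open>l\<close>.\<close>
    have "(\<Sum>i\<in>?F. \<Sum>j\<in>?F. c i * cnj (c j) * (k i x * k x j / k x x * l i j))
        = inverse (k x x) * (\<Sum>i\<in>?F. \<Sum>j\<in>?F. (c i * k i x) * cnj (c j * k j x) * l i j)"
      unfolding sum_distrib_left
      by (intro sum.cong refl) (simp add: herm[symmetric] divide_inverse mult_ac)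
    moreover have "inverse (k x x) \<in> \<real>\<^sub>\<ge>\<^sub>0" using r by simp
    ultimately show ?thesis
      using pos_kernelD[OF insert.prems(2), of ?F "\<lambda>i. c i * k i x"] insert.hyps by simp
  qed
  moreover have "(\<Sum>i\<in>?F. \<Sum>j\<in>?F. c i * cnj (c j) * (k i j * l i j))
      = (\<Sum>i\<in>?F. \<Sum>j\<in>?F. c i * cnj (c j) * (k' i j * l i j))
        + (\<Sum>i\<in>?F. \<Sum>j\<in>?F. c i * cnj (c j) * (k i x * k x j / k x x * l i j))"
    unfolding sum.distrib[symmetric]
    by (intro sum.cong refl) (simp add: k'_def algebra_simps)
  ultimately show ?case by simp
qed

lemma pos_kernel_mult:
  assumes "pos_kernel A k" "pos_kernel A l"
  shows "pos_kernel A (\<lambda>i j. k i j * l i j)"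
  unfolding pos_kernel_def
  using pos_kernel_mult_finite assms pos_kernel_subset by blast

lemma pos_kernel_cnj:
  assumes "pos_kernel A k"
  shows "pos_kernel A (\<lambda>i j. cnj (k i j))"
  unfolding pos_kernel_def
proof (intro allI impI)
  fix F c assume F: "finite F \<and> F \<subseteq> A"
  have "(\<Sum>i\<in>F. \<Sum>j\<in>F. c i * cnj (c j) * cnj (k i j))
      = cnj (\<Sum>i\<in>F. \<Sum>j\<in>F. cnj (c i) * cnj (cnj (c j)) * k i j)"
    by (simp add: mult_ac)
  then show "(\<Sum>i\<in>F. \<Sum>j\<in>F. c i * cnj (c j) * cnj (k i j)) \<in> \<real>\<^sub>\<ge>\<^sub>0"
    using pos_kernelD[OF assms, of F "\<lambda>i. cnj (c i)"] F
    by (simp only: cnj_mem_nonneg_Reals_iff)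
qed

lemma pos_kernel_one: "pos_kernel A (\<lambda>i j. 1)"
  unfolding pos_kernel_def
proof (intro allI impI)
  fix F and c :: "_ \<Rightarrow> complex" assume "finite F \<and> F \<subseteq> A"
  have "(\<Sum>i\<in>F. \<Sum>j\<in>F. c i * cnj (c j) * 1) = (\<Sum>i\<in>F. c i) * cnj (\<Sum>i\<in>F. c i)"
    by (simp add: sum_product)
  also have "\<dots> \<in> \<real>\<^sub>\<ge>\<^sub>0"
    by (rule mult_cnj_mem_nonneg_Reals)
  finally show "(\<Sum>i\<in>F. \<Sum>j\<in>F. c i * cnj (c j) * 1) \<in> \<real>\<^sub>\<ge>\<^sub>0" .
qed

section \<open>Traces\<close>

lemma positive_definite_iff_pos_kernel:
  "positive_definite G f \<longleftrightarrow> pos_kernel (carrier G) (\<lambda>g h. f (inv\<^bsub>G\<^esub> h \<otimes>\<^bsub>G\<^esub> g))"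
  by (simp add: positive_definite_def pos_kernel_def)

definition conjugation_invariant :: "('a, 'm) monoid_scheme \<Rightarrow> ('a \<Rightarrow> complex) \<Rightarrow> bool" where
  "conjugation_invariant G f \<longleftrightarrow>
     (\<forall>g\<in>carrier G. \<forall>x\<in>carrier G. f (x \<otimes>\<^bsub>G\<^esub> g \<otimes>\<^bsub>G\<^esub> inv\<^bsub>G\<^esub> x) = f g)"

lemma conjugation_invariantD:
  "conjugation_invariant G f \<Longrightarrow> g \<in> carrier G \<Longrightarrow> x \<in> carrier G \<Longrightarrow>
    f (x \<otimes>\<^bsub>G\<^esub> g \<otimes>\<^bsub>G\<^esub> inv\<^bsub>G\<^esub> x) = f g"
  by (simp add: conjugation_invariant_def)

lemma traces_iff:
  "f \<in> traces G \<longleftrightarrow> f \<in> extensional (carrier G) \<and> positive_definite G f \<and>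
     conjugation_invariant G f \<and> f \<one>\<^bsub>G\<^esub> = 1"
  by (auto simp: traces_def conjugation_invariant_def)

lemma charactersD:
  assumes "f \<in> characters G"
  shows "f \<in> traces G"
    and "\<lbrakk>\<alpha> \<in> traces G; \<beta> \<in> traces G; 0 < u; u < 1;
          \<And>g. g \<in> carrier G \<Longrightarrow> f g = of_real u * \<alpha> g + of_real (1 - u) * \<beta> g\<rbrakk> \<Longrightarrow> \<alpha> = \<beta>"
  using assms unfolding characters_def extreme_functions_def by blast+

context group
begin

lemma inv_mult_cancel:
  "x \<in> carrier G \<Longrightarrow> y \<in> carrier G \<Longrightarrow> inv x \<otimes> (x \<otimes> y) = y"
  "x \<in> carrier G \<Longrightarrow> y \<in> carrier G \<Longrightarrow> x \<otimes> (inv x \<otimes> y) = y"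
  by (simp_all flip: m_assoc)

lemma positive_definite_cong:
  assumes "\<And>g. g \<in> carrier G \<Longrightarrow> f g = f' g"
  shows "positive_definite G f \<longleftrightarrow> positive_definite G f'"
  unfolding positive_definite_iff_pos_kernel using assms by (intro pos_kernel_cong) auto

lemma positive_definite_one_nonneg: "positive_definite G f \<Longrightarrow> f \<one> \<in> \<real>\<^sub>\<ge>\<^sub>0"
  using pos_kernel_diag[of "carrier G" _ \<one>] by (fastforce simp: positive_definite_iff_pos_kernel)

lemma positive_definite_inv:
  assumes "positive_definite G f" "g \<in> carrier G"
  shows "f (inv g) = cnj (f g)"
  using pos_kernel_hermitian[OF assms(1)[unfolded positive_definite_iff_pos_kernel] assms(2) one_closed]
    assms(2) by simp

lemma positive_definite_bound:
  assumes "positive_definite G f" "g \<in> carrier G"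
  shows "cmod (f g) \<le> Re (f \<one>)"
proof -
  have "Re (f \<one>) \<ge> 0"
    using positive_definite_one_nonneg[OF assms(1)] by (simp add: complex_nonneg_Reals_iff)
  moreover have "(cmod (f g))\<^sup>2 \<le> (Re (f \<one>))\<^sup>2"
    using pos_kernel_Cauchy_Schwarz[OF assms(1)[unfolded positive_definite_iff_pos_kernel] assms(2) one_closed]
      assms(2) by (simp add: power2_eq_square)
  ultimately show ?thesis
    using power2_le_imp_le by blast
qed

lemma trace_bound: "\<phi> \<in> traces G \<Longrightarrow> g \<in> carrier G \<Longrightarrow> cmod (\<phi> g) \<le> 1"
  using positive_definite_bound[of \<phi> g] by (simp add: traces_iff)

lemma conjugation_invariant_commute:
  assumes "conjugation_invariant G f" "x \<in> carrier G" "y \<in> carrier G"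
  shows "f (x \<otimes> y) = f (y \<otimes> x)"
  using conjugation_invariantD[OF assms(1), of "y \<otimes> x" x] assms(2,3) by (simp add: m_assoc)

lemma positive_definite_pullback:
  assumes "positive_definite G f" "group K" "\<rho> \<in> hom K G"
  shows "positive_definite K (\<lambda>x. f (\<rho> x))"
proof -
  interpret K: group K by fact
  interpret \<rho>: group_hom K G \<rho> using assms by (simp add: group_hom_def group_hom_axioms_def group_axioms)
  have "pos_kernel (carrier K) (\<lambda>x y. f (inv \<rho> y \<otimes> \<rho> x))"
    by (rule pos_kernel_pullback[of "carrier G" "\<lambda>g h. f (inv h \<otimes> g)" \<rho>])
       (use assms(1) in \<open>auto simp: positive_definite_iff_pos_kernel\<close>)
  then show ?thesis
    unfolding positive_definite_iff_pos_kernel by (subst (asm) pos_kernel_cong) auto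
qed

lemma trace_pullback:
  assumes "\<phi> \<in> traces G" "group K" "\<rho> \<in> hom K G"
  shows "(\<lambda>x\<in>carrier K. \<phi> (\<rho> x)) \<in> traces K"
proof -
  interpret K: group K by fact
  interpret \<rho>: group_hom K G \<rho> using assms by (simp add: group_hom_def group_hom_axioms_def group_axioms)
  have "positive_definite K (\<lambda>x\<in>carrier K. \<phi> (\<rho> x))"
    using positive_definite_pullback[OF _ assms(2,3), of \<phi>] assms(1)
    by (subst K.positive_definite_cong[of _ "\<lambda>x. \<phi> (\<rho> x)"]) (auto simp: traces_iff)
  then show ?thesis
    using assms(1) by (auto simp: traces_iff conjugation_invariant_def)
qed

lemma trace_mult:
  assumes "\<phi> \<in> traces G" "\<psi> \<in> traces G"
  shows "(\<lambda>g\<in>carrier G. \<phi> g * \<psi> g) \<in> traces G"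
proof -
  have "positive_definite G (\<lambda>g\<in>carrier G. \<phi> g * \<psi> g)"
    by (subst positive_definite_cong[of _ "\<lambda>g. \<phi> g * \<psi> g"])
       (use assms in \<open>auto simp: traces_iff positive_definite_iff_pos_kernel intro: pos_kernel_mult\<close>)
  then show ?thesis
    using assms by (auto simp: traces_iff conjugation_invariant_def)
qed

lemma trace_cnj:
  assumes "\<phi> \<in> traces G"
  shows "(\<lambda>g\<in>carrier G. cnj (\<phi> g)) \<in> traces G"
proof -
  have "positive_definite G (\<lambda>g\<in>carrier G. cnj (\<phi> g))"
    by (subst positive_definite_cong[of _ "\<lambda>g. cnj (\<phi> g)"])
       (use assms in \<open>auto simp: traces_iff positive_definite_iff_pos_kernel intro: pos_kernel_cnj\<close>)
  then show ?thesis
    using assms by (auto simp: traces_iff conjugation_invariant_def)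
qed

lemma trace_one: "(\<lambda>g\<in>carrier G. 1) \<in> traces G"
proof -
  have "positive_definite G (\<lambda>g\<in>carrier G. 1)"
    by (subst positive_definite_cong[of _ "\<lambda>g. 1"])
       (auto simp: positive_definite_iff_pos_kernel pos_kernel_one)
  then show ?thesis
    by (auto simp: traces_iff conjugation_invariant_def)
qed

lemma trace_prod:
  assumes "\<And>i. i \<in> I \<Longrightarrow> \<phi> i \<in> traces G"
  shows "(\<lambda>g\<in>carrier G. \<Prod>i\<in>I. \<phi> i g) \<in> traces G"
  using assms
proof (induction I rule: infinite_finite_induct)
  case (insert i I)
  then have "(\<lambda>g\<in>carrier G. \<phi> i g * (\<lambda>g\<in>carrier G. \<Prod>i\<in>I. \<phi> i g) g) \<in> traces G"
    by (intro trace_mult) auto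
  also have "(\<lambda>g\<in>carrier G. \<phi> i g * (\<lambda>g\<in>carrier G. \<Prod>i\<in>I. \<phi> i g) g)
      = (\<lambda>g\<in>carrier G. \<Prod>i\<in>insert i I. \<phi> i g)"
    using insert.hyps by auto
  finally show ?case .
qed (use trace_one in auto)

lemma trace_limit:
  assumes "\<And>n. \<phi> n \<in> traces G" and "\<Phi> \<in> extensional (carrier G)"
    and "\<And>g. g \<in> carrier G \<Longrightarrow> (\<lambda>n::nat. \<phi> n g) \<longlonglongrightarrow> \<Phi> g"
  shows "\<Phi> \<in> traces G"
proof -
  have "positive_definite G \<Phi>"
    unfolding positive_definite_iff_pos_kernel
    by (rule pos_kernel_limit[where k = "\<lambda>n g h. \<phi> n (inv h \<otimes> g)"])
       (use assms in \<open>auto simp: traces_iff positive_definite_iff_pos_kernel\<close>)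
  moreover have "\<Phi> (x \<otimes> g \<otimes> inv x) = \<Phi> g" if "g \<in> carrier G" "x \<in> carrier G" for g x
  proof (rule LIMSEQ_unique)
    show "(\<lambda>n. \<phi> n (x \<otimes> g \<otimes> inv x)) \<longlonglongrightarrow> \<Phi> (x \<otimes> g \<otimes> inv x)"
      using that by (intro assms(3)) auto
    show "(\<lambda>n. \<phi> n (x \<otimes> g \<otimes> inv x)) \<longlonglongrightarrow> \<Phi> g"
      using assms(1,3) that by (simp add: traces_iff conjugation_invariant_def)
  qed
  moreover have "\<Phi> \<one> = 1"
    by (rule LIMSEQ_unique[OF assms(3)[OF one_closed]]) (use assms(1) in \<open>simp add: traces_iff\<close>)
  ultimately show ?thesis
    using assms(2) by (auto simp: traces_iff conjugation_invariant_def)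
qed

section \<open>Extreme traces and class sums\<close>

lemma trace_normalize:
  assumes f: "positive_definite G f" "conjugation_invariant G f" and a: "f \<one> = of_real a" "a > 0"
  shows "(\<lambda>g\<in>carrier G. f g / of_real a) \<in> traces G"
proof -
  have "pos_kernel (carrier G) (\<lambda>g h. inverse (of_real a) * f (inv h \<otimes> g))"
    by (rule pos_kernel_scale) (use f a in \<open>auto simp: positive_definite_iff_pos_kernel\<close>)
  then have "positive_definite G (\<lambda>g\<in>carrier G. f g / of_real a)"
    by (subst positive_definite_cong[of _ "\<lambda>g. inverse (of_real a) * f g"])
       (auto simp: positive_definite_iff_pos_kernel field_simps)
  then show ?thesis
    using f a by (auto simp: traces_iff conjugation_invariant_def)
qed

text \<open>Extremality for summands of any mass. A summand of mass zero cannot be normalized, but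
  it vanishes identically because its value at \<open>\<one>\<close> bounds it.\<close>

lemma character_split:
  assumes \<zeta>: "\<zeta> \<in> characters G"
    and \<alpha>: "positive_definite G \<alpha>" "conjugation_invariant G \<alpha>"
    and \<beta>: "positive_definite G \<beta>" "conjugation_invariant G \<beta>"
    and sum: "\<And>g. g \<in> carrier G \<Longrightarrow> \<zeta> g = \<alpha> g + \<beta> g"
    and g: "g \<in> carrier G"
  shows "\<alpha> g = \<alpha> \<one> * \<zeta> g"
proof -
  define a where "a = Re (\<alpha> \<one>)"
  define b where "b = Re (\<beta> \<one>)"
  have a: "\<alpha> \<one> = of_real a" "a \<ge> 0" and b: "\<beta> \<one> = of_real b" "b \<ge> 0"
    using positive_definite_one_nonneg[OF \<alpha>(1)] positive_definite_one_nonneg[OF \<beta>(1)]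
    by (auto simp: a_def b_def complex_nonneg_Reals_iff complex_eq_iff)
  have "complex_of_real (a + b) = 1"
    using sum[OF one_closed] charactersD(1)[OF \<zeta>] a b by (simp add: traces_iff)
  then have ab: "a + b = 1"
    using of_real_eq_1_iff by blast
  consider "a = 0" | "b = 0" | "a > 0" "b > 0" using a b by fastforce
  then show ?thesis
  proof cases
    case 1
    then show ?thesis
      using positive_definite_bound[OF \<alpha>(1) g] a by simp
  next
    case 2
    then show ?thesis
      using positive_definite_bound[OF \<beta>(1) g] a b ab sum[OF g] by simp
  next
    case 3
    let ?\<alpha> = "\<lambda>g\<in>carrier G. \<alpha> g / of_real a" and ?\<beta> = "\<lambda>g\<in>carrier G. \<beta> g / of_real b"
    have "?\<alpha> = ?\<beta>"
    proof (rule charactersD(2)[OF \<zeta>])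
      show "?\<alpha> \<in> traces G" "?\<beta> \<in> traces G"
        by (intro trace_normalize \<alpha> \<beta> a b 3)+
      show "0 < a" "a < 1" using 3 ab by auto
      have [simp]: "1 - a = b" using ab by simp
      show "\<zeta> g = of_real a * ?\<alpha> g + of_real (1 - a) * ?\<beta> g" if "g \<in> carrier G" for g
        using sum[OF that] that 3 by simp
    qed
    then have "?\<alpha> g = ?\<beta> g" by (rule fun_cong)
    then have "\<alpha> g / of_real a = \<beta> g / of_real b"
      using g by simp
    then have "of_real b * \<alpha> g = of_real a * \<beta> g"
      using 3 by (simp add: field_simps)
    moreover have "of_real b = 1 - complex_of_real a"
      using ab by (metis add_diff_cancel_left' of_real_1 of_real_diff)
    ultimately show ?thesis
      using sum[OF g] a by (simp add: algebra_simps)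
  qed
qed

text \<open>The class sum \<open>z\<close> of \<open>C\<close> is central in the group algebra. For \<open>\<bar>l\<bar> = 1\<close> the central elements
  \<open>(2 + l z + (l z)\<^sup>*) / 4\<close>, suitably normalized, are averages of \<open>(1 + l y)\<^sup>* (1 + l y) / 4\<close>;
  those for \<open>l\<close> and \<open>- l\<close> are positive with sum \<open>1\<close> and hence split an extreme trace.\<close>

lemma character_class_sum:
  assumes \<zeta>: "\<zeta> \<in> characters G"
    and C: "finite C" "C \<subseteq> carrier G" "\<And>x y. x \<in> carrier G \<Longrightarrow> y \<in> C \<Longrightarrow> x \<otimes> y \<otimes> inv x \<in> C"
    and g: "g \<in> carrier G"
  shows "(\<Sum>y\<in>C. \<zeta> (y \<otimes> g)) = (\<Sum>y\<in>C. \<zeta> y) * \<zeta> g"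
proof (cases "C = {}")
  case False
  note \<zeta>t = charactersD(1)[OF \<zeta>, unfolded traces_iff]
  note comm = conjugation_invariant_commute[of \<zeta>]
  have yC: "y \<in> carrier G" if "y \<in> C" for y using C(2) that by auto
  \<comment> \<open>With this \<open>m\<close> the parts depending on \<open>l\<close> cancel in
    \<open>\<alpha> l + \<alpha> (- l)\<close>, and the remaining \<open>card C\<close> terms
    \<open>4 * \<zeta> g\<close> add up to \<open>\<zeta> g\<close>.\<close>
  define m where "m = 1 / complex_of_real (4 * card C)"
  define \<alpha> where "\<alpha> l g = m * (\<Sum>y\<in>C. 2 * \<zeta> g + l * \<zeta> (y \<otimes> g) + cnj l * \<zeta> (inv y \<otimes> g))" for l g
  have m: "m \<in> \<real>\<^sub>\<ge>\<^sub>0" "4 * card C * m = 1"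
    using C(1) False by (simp_all add: m_def)
  \<comment> \<open>Conjugating all of \<open>C\<close> only permutes the summands. This is the
    centrality of the class sum; it lets \<open>y\<close> be moved past \<open>h\<close>.\<close>
  have shift: "(\<Sum>y\<in>C. F (inv h \<otimes> y \<otimes> h)) = (\<Sum>y\<in>C. F y)" if "h \<in> carrier G" for h and F :: "_ \<Rightarrow> complex"
    by (rule sum.reindex_bij_witness[of _ "\<lambda>y. h \<otimes> y \<otimes> inv h" "\<lambda>y. inv h \<otimes> y \<otimes> h"])
       (use that C(3)[of "inv h"] C(3)[of h] yC in \<open>auto simp: m_assoc inv_mult_cancel\<close>)
  have inv_shift: "inv (inv h \<otimes> y \<otimes> h) = inv h \<otimes> inv y \<otimes> h" if "h \<in> carrier G" "y \<in> C" for h y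
    using that yC by (simp add: inv_mult_group m_assoc)
  have pd: "positive_definite G (\<alpha> l)" if l: "l * cnj l = 1" for l
  proof -
    \<comment> \<open>\<open>False\<close> stands for the vector at \<open>g\<close>,
      \<open>True\<close> for \<open>l\<close> times the vector at \<open>y \<otimes> g\<close>.
      Both diagonal products are \<open>\<zeta> (inv h \<otimes> g)\<close>, as \<open>l\<close> has
      modulus 1.\<close>
    define a where "a p = (if p then l else 1)" for p
    define T where "T y p g = (if p then y \<otimes> g else g)" for y p g
    have k: "pos_kernel (carrier G) (\<lambda>g h. \<zeta> (inv h \<otimes> g))"
      using \<zeta>t by (simp add: positive_definite_iff_pos_kernel)
    have "pos_kernel (carrier G) (\<lambda>g h. m * (\<Sum>y\<in>C. \<Sum>p\<in>UNIV. \<Sum>q\<in>UNIV.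
            a p * cnj (a q) * \<zeta> (inv (T y q h) \<otimes> T y p g)))"
      by (intro pos_kernel_scale pos_kernel_sum m(1)
            pos_kernel_combine[OF k, where a = "\<lambda>p _. a p"]) (use yC in \<open>auto simp: T_def\<close>)
    moreover have "m * (\<Sum>y\<in>C. \<Sum>p\<in>UNIV. \<Sum>q\<in>UNIV.
            a p * cnj (a q) * \<zeta> (inv (T y q h) \<otimes> T y p g)) = \<alpha> l (inv h \<otimes> g)"
      if gh: "g \<in> carrier G" "h \<in> carrier G" for g h
    proof -
      have "\<alpha> l (inv h \<otimes> g) = m * (\<Sum>y\<in>C. 2 * \<zeta> (inv h \<otimes> g)
          + l * \<zeta> (inv h \<otimes> y \<otimes> h \<otimes> (inv h \<otimes> g)) + cnj l * \<zeta> (inv (inv h \<otimes> y \<otimes> h) \<otimes> (inv h \<otimes> g)))"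
        unfolding \<alpha>_def by (subst shift[OF gh(2), symmetric]) (rule refl)
      also have "\<dots> = m * (\<Sum>y\<in>C. \<Sum>p\<in>UNIV. \<Sum>q\<in>UNIV.
            a p * cnj (a q) * \<zeta> (inv (T y q h) \<otimes> T y p g))"
        using gh yC l
        by (intro arg_cong[where f = "\<lambda>s. m * s"] sum.cong refl)
           (simp add: inv_shift UNIV_bool a_def T_def inv_mult_group m_assoc inv_mult_cancel algebra_simps)
      finally show ?thesis by simp
    qed
    ultimately show ?thesis
      unfolding positive_definite_iff_pos_kernel by (subst (asm) pos_kernel_cong) auto
  qed
  have ci: "conjugation_invariant G (\<alpha> l)" for l
    unfolding conjugation_invariant_def
  proof (intro ballI)
    fix g x assume gx: "g \<in> carrier G" "x \<in> carrier G"
    have conj: "\<zeta> (x \<otimes> w \<otimes> inv x) = \<zeta> w" if "w \<in> carrier G" for w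
      using \<zeta>t gx that by (simp add: conjugation_invariant_def)
    have "\<alpha> l g = m * (\<Sum>y\<in>C. 2 * \<zeta> g
          + l * \<zeta> (inv x \<otimes> y \<otimes> x \<otimes> g) + cnj l * \<zeta> (inv (inv x \<otimes> y \<otimes> x) \<otimes> g))"
      unfolding \<alpha>_def by (subst shift[OF gx(2), symmetric]) (rule refl)
    also have "\<dots> = \<alpha> l (x \<otimes> g \<otimes> inv x)"
      unfolding \<alpha>_def
    proof (intro arg_cong[where f = "\<lambda>s. m * s"] sum.cong refl)
      fix y assume y: "y \<in> C"
      have "y \<otimes> (x \<otimes> g \<otimes> inv x) = x \<otimes> (inv x \<otimes> y \<otimes> x \<otimes> g) \<otimes> inv x"
        "inv y \<otimes> (x \<otimes> g \<otimes> inv x) = x \<otimes> (inv x \<otimes> inv y \<otimes> x \<otimes> g) \<otimes> inv x"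
        using gx yC[OF y] by (simp_all add: m_assoc inv_mult_cancel)
      then show "2 * \<zeta> g + l * \<zeta> (inv x \<otimes> y \<otimes> x \<otimes> g) + cnj l * \<zeta> (inv (inv x \<otimes> y \<otimes> x) \<otimes> g)
          = 2 * \<zeta> (x \<otimes> g \<otimes> inv x) + l * \<zeta> (y \<otimes> (x \<otimes> g \<otimes> inv x)) + cnj l * \<zeta> (inv y \<otimes> (x \<otimes> g \<otimes> inv x))"
        using gx yC[OF y] y by (simp only: conj inv_shift m_closed inv_closed)
    qed
    finally show "\<alpha> l (x \<otimes> g \<otimes> inv x) = \<alpha> l g" ..
  qed
  have sum_eq: "\<zeta> g = \<alpha> l g + \<alpha> (- l) g" for l g
  proof -
    have "\<alpha> l g + \<alpha> (- l) g = m * (\<Sum>y\<in>C. 4 * \<zeta> g)"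
      unfolding \<alpha>_def distrib_left[symmetric] sum.distrib[symmetric]
      by (intro arg_cong[where f = "\<lambda>s. m * s"] sum.cong refl) simp
    also have "\<dots> = (4 * card C * m) * \<zeta> g" by simp
    finally show ?thesis by (simp only: m(2)) simp
  qed
  have split: "\<alpha> l g = \<alpha> l \<one> * \<zeta> g" if "l * cnj l = 1" for l
    using that by (intro character_split[OF \<zeta> pd ci pd ci sum_eq g]) auto
  define A where "A = (\<Sum>y\<in>C. \<zeta> (y \<otimes> g))"
  define B where "B = (\<Sum>y\<in>C. \<zeta> (inv y \<otimes> g))"
  define A1 where "A1 = (\<Sum>y\<in>C. \<zeta> y)"
  define B1 where "B1 = (\<Sum>y\<in>C. \<zeta> (inv y))"
  have \<alpha>g: "\<alpha> l g = m * (2 * card C * \<zeta> g + l * A + cnj l * B)" for l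
    unfolding \<alpha>_def A_def B_def by (simp add: sum.distrib sum_distrib_left)
  have \<alpha>1: "\<alpha> l \<one> = m * (2 * card C + l * A1 + cnj l * B1)" for l
    unfolding \<alpha>_def A1_def B1_def using \<zeta>t yC by (simp add: sum.distrib sum_distrib_left)
  have "m \<noteq> 0" using m(2) by auto
  have eq: "l * A + cnj l * B = (l * A1 + cnj l * B1) * \<zeta> g" if "l * cnj l = 1" for l
  proof -
    have "m * (2 * card C * \<zeta> g + l * A + cnj l * B) = m * ((2 * card C + l * A1 + cnj l * B1) * \<zeta> g)"
      using split[OF that] unfolding \<alpha>g \<alpha>1 mult.assoc[of m] .
    then have "2 * card C * \<zeta> g + l * A + cnj l * B = (2 * card C + l * A1 + cnj l * B1) * \<zeta> g"
      using \<open>m \<noteq> 0\<close> by (simp only: mult_cancel_left simp_thms)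
    then show ?thesis by (simp add: algebra_simps)
  qed
  \<comment> \<open>\<open>C\<close> need not be closed under inverses, so \<open>A\<close> and
    \<open>B\<close> may differ; the values \<open>1\<close> and \<open>\<i>\<close> of
    \<open>l\<close> give their sum and difference and so isolate \<open>A\<close>.\<close>
  have "A + B = (A1 + B1) * \<zeta> g" using eq[of 1] by simp
  moreover have "A - B = (A1 - B1) * \<zeta> g"
  proof -
    have "\<i> * (A - B) = \<i> * ((A1 - B1) * \<zeta> g)" using eq[of \<i>] by (simp add: algebra_simps)
    then show ?thesis by simp
  qed
  ultimately have "(A + B) + (A - B) = (A1 + B1) * \<zeta> g + (A1 - B1) * \<zeta> g" by (simp only:)
  then have "2 * A = 2 * (A1 * \<zeta> g)" by (simp add: algebra_simps)
  then show ?thesis by (simp add: A_def A1_def)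
qed simp

text \<open>The squared length of \<open>(\<Sum>y\<in>C. y) - b\<close> in the GNS representation of \<open>\<alpha>\<close>.\<close>

definition (in -) class_defect ::
    "('a, 'm) monoid_scheme \<Rightarrow> 'a set \<Rightarrow> complex \<Rightarrow> ('a \<Rightarrow> complex) \<Rightarrow> complex" where
  "class_defect G C b \<alpha> = (\<Sum>x\<in>C. \<Sum>y\<in>C. \<alpha> (inv\<^bsub>G\<^esub> y \<otimes>\<^bsub>G\<^esub> x))
     - cnj b * (\<Sum>y\<in>C. \<alpha> y) - b * cnj (\<Sum>y\<in>C. \<alpha> y) + b * cnj b * \<alpha> \<one>\<^bsub>G\<^esub>"

text \<open>Displays the defect as the square length of explicit coefficients. The property for all
  \<open>f\<close> lets the same coefficients be paired with any function.\<close>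

lemma class_defect_sum:
  assumes \<alpha>: "positive_definite G \<alpha>" and C: "finite C" "C \<subseteq> carrier G"
  obtains I v where "finite I" "I \<subseteq> carrier G"
    "\<And>f. (\<Sum>p\<in>I. v p * f p) = (\<Sum>y\<in>C. f y) - b * f \<one>"
    "(\<Sum>p\<in>I. \<Sum>q\<in>I. v p * cnj (v q) * \<alpha> (inv q \<otimes> p)) = class_defect G C b \<alpha>"
proof -
  define I where "I = insert \<one> C"
  \<comment> \<open>Two separate indicators, because \<open>\<one>\<close> may belong to
    \<open>C\<close>.\<close>
  define v where "v p = (if p \<in> C then 1 else 0) - (if p = \<one> then b else 0)" for p
  have I: "finite I" "I \<subseteq> carrier G" "\<one> \<in> I" "C \<subseteq> I" using C by (auto simp: I_def)
  have indC: "(\<Sum>p\<in>I. (if p \<in> C then f p else 0)) = (\<Sum>y\<in>C. f y)" for f :: "_ \<Rightarrow> complex"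
    using I by (simp add: sum.If_cases Int_absorb1)
  have v1: "(\<Sum>p\<in>I. v p * f p) = (\<Sum>y\<in>C. f y) - b * f \<one>" for f
  proof -
    have "(\<Sum>p\<in>I. v p * f p) = (\<Sum>p\<in>I. (if p \<in> C then f p else 0) - (if p = \<one> then b * f p else 0))"
      by (intro sum.cong refl) (auto simp: v_def algebra_simps)
    then show ?thesis using I by (simp add: sum_subtractf indC)
  qed
  have v2: "(\<Sum>p\<in>I. cnj (v p) * f p) = (\<Sum>y\<in>C. f y) - cnj b * f \<one>" for f
  proof -
    have "(\<Sum>p\<in>I. cnj (v p) * f p)
        = (\<Sum>p\<in>I. (if p \<in> C then f p else 0) - (if p = \<one> then cnj b * f p else 0))"
      by (intro sum.cong refl) (auto simp: v_def algebra_simps)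
    then show ?thesis using I by (simp add: sum_subtractf indC)
  qed
  have inv_sum: "(\<Sum>y\<in>C. \<alpha> (inv y)) = cnj (\<Sum>y\<in>C. \<alpha> y)"
    using C positive_definite_inv[OF \<alpha>] by (auto intro!: sum.cong)
  have "(\<Sum>p\<in>I. \<Sum>q\<in>I. v p * cnj (v q) * \<alpha> (inv q \<otimes> p))
      = (\<Sum>p\<in>I. v p * ((\<Sum>y\<in>C. \<alpha> (inv y \<otimes> p)) - cnj b * \<alpha> (inv \<one> \<otimes> p)))"
    by (simp add: mult.assoc v2 flip: sum_distrib_left)
  also have "\<dots> = (\<Sum>x\<in>C. (\<Sum>y\<in>C. \<alpha> (inv y \<otimes> x)) - cnj b * \<alpha> (inv \<one> \<otimes> x))
      - b * ((\<Sum>y\<in>C. \<alpha> (inv y \<otimes> \<one>)) - cnj b * \<alpha> (inv \<one> \<otimes> \<one>))"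
    by (rule v1)
  also have "\<dots> = class_defect G C b \<alpha>"
  proof -
    have "(\<Sum>y\<in>C. \<alpha> (inv y \<otimes> \<one>)) = (\<Sum>y\<in>C. \<alpha> (inv y))"
      "(\<Sum>x\<in>C. \<alpha> (inv \<one> \<otimes> x)) = (\<Sum>x\<in>C. \<alpha> x)"
      using C by (auto intro!: sum.cong)
    then show ?thesis
      by (simp add: class_defect_def sum_subtractf inv_sum algebra_simps flip: sum_distrib_left)
  qed
  finally show ?thesis using that I v1 by blast
qed

lemma class_defect_nonneg:
  assumes "positive_definite G \<alpha>" "finite C" "C \<subseteq> carrier G"
  shows "class_defect G C b \<alpha> \<in> \<real>\<^sub>\<ge>\<^sub>0"
proof -
  obtain I v where I: "finite I" "I \<subseteq> carrier G"
    and Q: "(\<Sum>p\<in>I. \<Sum>q\<in>I. v p * cnj (v q) * \<alpha> (inv q \<otimes> p)) = class_defect G C b \<alpha>"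
    by (rule class_defect_sum[OF assms, of b])
  show ?thesis
    using pos_kernelD[OF assms(1)[unfolded positive_definite_iff_pos_kernel] I, of v] Q by simp
qed

text \<open>The class sum minus \<open>b\<close> is then a null vector, hence orthogonal to the
  vector at \<open>inv g\<close>, and this pairing evaluates \<open>\<alpha>\<close> at
  \<open>g \<otimes> y\<close>.\<close>

lemma class_defect_zero:
  assumes \<alpha>: "positive_definite G \<alpha>" "conjugation_invariant G \<alpha>" and C: "finite C" "C \<subseteq> carrier G"
    and zero: "class_defect G C b \<alpha> = 0" and g: "g \<in> carrier G"
  shows "(\<Sum>y\<in>C. \<alpha> (y \<otimes> g)) = b * \<alpha> g"
proof -
  obtain I v where I: "finite I" "I \<subseteq> carrier G"
    and v: "\<And>f. (\<Sum>p\<in>I. v p * f p) = (\<Sum>y\<in>C. f y) - b * f \<one>"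
    and Q: "(\<Sum>p\<in>I. \<Sum>q\<in>I. v p * cnj (v q) * \<alpha> (inv q \<otimes> p)) = class_defect G C b \<alpha>"
    by (rule class_defect_sum[OF \<alpha>(1) C, of b]) (rule that; (assumption | blast))
  have "(\<Sum>p\<in>I. v p * \<alpha> (inv (inv g) \<otimes> p)) = 0"
    by (rule pos_kernel_null[OF \<alpha>(1)[unfolded positive_definite_iff_pos_kernel] I, of "inv g" v])
       (use g Q zero in auto)
  then have "(\<Sum>y\<in>C. \<alpha> (g \<otimes> y)) = b * \<alpha> g"
    using g by (simp add: v)
  moreover have "(\<Sum>y\<in>C. \<alpha> (g \<otimes> y)) = (\<Sum>y\<in>C. \<alpha> (y \<otimes> g))"
    using C g conjugation_invariant_commute[OF \<alpha>(2)] by (intro sum.cong) auto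
  ultimately show ?thesis by simp
qed

text \<open>Converse of \<open>class_defect_zero\<close>: at inverses, multiplicativity turns the
  double sum into \<open>s * cnj s\<close>, and the four terms of the defect cancel.\<close>

lemma class_defect_multiplicative:
  assumes \<phi>: "\<phi> \<in> traces G" and C: "C \<subseteq> carrier G"
    and mult: "\<And>g. g \<in> carrier G \<Longrightarrow> (\<Sum>y\<in>C. \<phi> (y \<otimes> g)) = (\<Sum>y\<in>C. \<phi> y) * \<phi> g"
  shows "class_defect G C (\<Sum>y\<in>C. \<phi> y) \<phi> = 0"
proof -
  define s where "s = (\<Sum>y\<in>C. \<phi> y)"
  have pd: "positive_definite G \<phi>" and ci: "conjugation_invariant G \<phi>" and one: "\<phi> \<one> = 1"
    using \<phi> by (auto simp: traces_iff)
  have "(\<Sum>x\<in>C. \<Sum>y\<in>C. \<phi> (inv y \<otimes> x)) = (\<Sum>y\<in>C. \<Sum>x\<in>C. \<phi> (inv y \<otimes> x))"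
    by (rule sum.swap)
  also have "\<dots> = (\<Sum>y\<in>C. \<Sum>x\<in>C. \<phi> (x \<otimes> inv y))"
    using conjugation_invariant_commute[OF ci] by (intro sum.cong refl) (simp add: subsetD[OF C])
  also have "\<dots> = (\<Sum>y\<in>C. s * cnj (\<phi> y))"
    using C mult positive_definite_inv[OF pd] by (intro sum.cong refl) (auto simp: s_def)
  also have "\<dots> = s * cnj s"
    by (simp add: s_def flip: sum_distrib_left)
  finally show ?thesis
    by (simp add: class_defect_def one flip: s_def)
qed

section \<open>Conjugacy classes and a criterion for extremality\<close>

definition (in -) conj_class :: "('a, 'm) monoid_scheme \<Rightarrow> 'a \<Rightarrow> 'a set" where
  "conj_class G h = (\<lambda>x. x \<otimes>\<^bsub>G\<^esub> h \<otimes>\<^bsub>G\<^esub> inv\<^bsub>G\<^esub> x) ` carrier G"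

lemma conj_class_subset: "h \<in> carrier G \<Longrightarrow> conj_class G h \<subseteq> carrier G"
  by (auto simp: conj_class_def)

lemma conj_class_self: "h \<in> carrier G \<Longrightarrow> h \<in> conj_class G h"
  unfolding conj_class_def by (rule image_eqI[of _ _ \<one>]) auto

lemma conj_class_conj:
  assumes "h \<in> carrier G" "x \<in> carrier G" "y \<in> conj_class G h"
  shows "x \<otimes> y \<otimes> inv x \<in> conj_class G h"
proof -
  obtain z where z: "z \<in> carrier G" "y = z \<otimes> h \<otimes> inv z"
    using assms(3) by (auto simp: conj_class_def)
  then have "x \<otimes> y \<otimes> inv x = (x \<otimes> z) \<otimes> h \<otimes> inv (x \<otimes> z)"
    using assms by (simp add: m_assoc inv_mult_group)
  then show ?thesis using assms z by (auto simp: conj_class_def)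
qed

lemma sum_conj_class:
  assumes "conjugation_invariant G f" "h \<in> carrier G"
  shows "(\<Sum>y\<in>conj_class G h. f y) = of_nat (card (conj_class G h)) * f h"
proof -
  have "(\<Sum>y\<in>conj_class G h. f y) = (\<Sum>y\<in>conj_class G h. f h)"
    using assms by (intro sum.cong refl) (auto simp: conj_class_def conjugation_invariant_def)
  then show ?thesis by simp
qed

text \<open>For fixed \<open>b\<close> the defect is linear in the function and nonnegative on
  traces. If it vanishes at a convex combination, it vanishes at both parts; this fixes their class
  sums and, by conjugation invariance, their values.\<close>

lemma characterI:
  assumes \<phi>: "\<phi> \<in> traces G"
    and fin: "\<And>h. h \<in> carrier G \<Longrightarrow> finite (conj_class G h)"
    and mult: "\<And>h g. h \<in> carrier G \<Longrightarrow> g \<in> carrier G \<Longrightarrow>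
       (\<Sum>y\<in>conj_class G h. \<phi> (y \<otimes> g)) = (\<Sum>y\<in>conj_class G h. \<phi> y) * \<phi> g"
  shows "\<phi> \<in> characters G"
proof -
  have "\<alpha> = \<beta>" if \<alpha>: "\<alpha> \<in> traces G" and \<beta>: "\<beta> \<in> traces G" and u: "0 < u" "u < 1"
    and eq: "\<And>g. g \<in> carrier G \<Longrightarrow> \<phi> g = of_real u * \<alpha> g + of_real (1 - u) * \<beta> g" for \<alpha> \<beta> u
  proof -
    have eq\<phi>: "\<alpha> h = \<phi> h \<and> \<beta> h = \<phi> h" if h: "h \<in> carrier G" for h
    proof -
      define C where "C = conj_class G h"
      have C: "finite C" "C \<subseteq> carrier G" and h_C: "h \<in> C"
        using fin[OF h] conj_class_subset[OF h] conj_class_self[OF h] by (auto simp: C_def)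
      have card: "complex_of_nat (card C) \<noteq> 0" using C h_C by auto
      \<comment> \<open>\<open>b\<close> is taken from \<open>\<phi>\<close> and kept for
        \<open>\<alpha>\<close> and \<open>\<beta>\<close>; otherwise \<open>d\<close> would not be
        linear.\<close>
      define b where "b = (\<Sum>y\<in>C. \<phi> y)"
      define d where "d f = class_defect G C b f" for f
      have "d \<phi> = of_real u * d \<alpha> + of_real (1 - u) * d \<beta>"
      proof -
        have 1: "(\<Sum>x\<in>C. \<Sum>y\<in>C. \<phi> (inv y \<otimes> x)) = of_real u * (\<Sum>x\<in>C. \<Sum>y\<in>C. \<alpha> (inv y \<otimes> x))
            + of_real (1 - u) * (\<Sum>x\<in>C. \<Sum>y\<in>C. \<beta> (inv y \<otimes> x))"
          unfolding sum_distrib_left sum.distrib[symmetric]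
          by (intro sum.cong refl eq) (use C in auto)
        have 2: "(\<Sum>y\<in>C. \<phi> y) = of_real u * (\<Sum>y\<in>C. \<alpha> y) + of_real (1 - u) * (\<Sum>y\<in>C. \<beta> y)"
          unfolding sum_distrib_left sum.distrib[symmetric]
          by (intro sum.cong refl eq) (use C in auto)
        show ?thesis
          unfolding d_def class_defect_def 1 2 eq[OF one_closed] by (simp add: algebra_simps)
      qed
      moreover have "d \<phi> = 0"
        unfolding d_def b_def using \<phi> C mult[OF h] by (intro class_defect_multiplicative) (auto simp: C_def)
      moreover have "d \<alpha> \<in> \<real>\<^sub>\<ge>\<^sub>0" "d \<beta> \<in> \<real>\<^sub>\<ge>\<^sub>0"
        unfolding d_def using \<alpha> \<beta> C by (auto simp: traces_iff intro: class_defect_nonneg)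
      ultimately have "Re (d \<alpha>) * u + Re (d \<beta>) * (1 - u) = 0"
          "Re (d \<alpha>) \<ge> 0" "Re (d \<beta>) \<ge> 0" "Im (d \<alpha>) = 0" "Im (d \<beta>) = 0"
        by (auto simp: complex_nonneg_Reals_iff complex_eq_iff algebra_simps)
      then have "d \<alpha> = 0" "d \<beta> = 0"
        using u by (auto simp: add_nonneg_eq_0_iff complex_eq_iff)
      have "f h = \<phi> h" if f: "f \<in> traces G" and "d f = 0" for f
      proof -
        have "(\<Sum>y\<in>C. f (y \<otimes> \<one>)) = b * f \<one>"
          using f C that(2) by (intro class_defect_zero) (auto simp: traces_iff d_def)
        moreover have "(\<Sum>y\<in>C. f (y \<otimes> \<one>)) = (\<Sum>y\<in>C. f y)"
          using C by (intro sum.cong refl) auto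
        ultimately have "(\<Sum>y\<in>C. f y) = (\<Sum>y\<in>C. \<phi> y)"
          using f by (simp add: traces_iff b_def)
        then show ?thesis
          using sum_conj_class[of f h] sum_conj_class[of \<phi> h] f \<phi> h card by (simp add: traces_iff C_def)
      qed
      then show ?thesis using \<alpha> \<beta> \<open>d \<alpha> = 0\<close> \<open>d \<beta> = 0\<close> by blast
    qed
    show ?thesis
    proof
      show "\<alpha> g = \<beta> g" for g
        using eq\<phi>[of g] \<alpha> \<beta> by (cases "g \<in> carrier G") (auto simp: traces_iff extensional_def)
    qed
  qed
  then show ?thesis
    unfolding characters_def extreme_functions_def using \<phi> by blast
qed

end

section \<open>Groups between a direct sum and a direct product\<close>

text \<open>Both the diagonal product and the direct sum itself are instances; the second serves to
  show that restrictions to the direct sum are characters.\<close>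

locale product_subgroup =
  fixes H :: "nat \<Rightarrow> ('b, 'k) monoid_scheme" and D :: "(nat \<Rightarrow> 'b) set"
  assumes groups: "group (H n)"
    and finite_groups: "finite (carrier (H n))"
    and subgroup: "subgroup D (product_group UNIV H)"
    and sum_subset: "carrier (sum_group UNIV H) \<subseteq> D"
begin

abbreviation \<Delta> :: "(nat \<Rightarrow> 'b) monoid" where
  "\<Delta> \<equiv> (product_group UNIV H)\<lparr>carrier := D\<rparr>"

lemma group_\<Delta>: "group \<Delta>"
  by (rule subgroup.subgroup_is_group[OF subgroup]) (simp add: groups)

sublocale \<Delta>: group \<Delta>
  by (rule group_\<Delta>)

lemma sum_iff: "x \<in> carrier (sum_group UNIV H) \<longleftrightarrow>
    (\<forall>n. x n \<in> carrier (H n)) \<and> finite {n. x n \<noteq> \<one>\<^bsub>H n\<^esub>}"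
  using carrier_sum_group[of UNIV H] groups by (auto simp: PiE_iff)

lemma closed: "x \<in> D \<Longrightarrow> x n \<in> carrier (H n)"
  using subgroup.subset[OF subgroup] by (auto simp: PiE_iff subset_iff)

lemma mult_\<Delta>: "x \<otimes>\<^bsub>\<Delta>\<^esub> y = (\<lambda>n. x n \<otimes>\<^bsub>H n\<^esub> y n)"
  by (simp add: restrict_def)

lemma one_\<Delta>: "\<one>\<^bsub>\<Delta>\<^esub> = (\<lambda>n. \<one>\<^bsub>H n\<^esub>)"
  by (simp add: restrict_def)

lemma inv_\<Delta>:
  assumes "x \<in> D"
  shows "inv\<^bsub>\<Delta>\<^esub> x = (\<lambda>n. inv\<^bsub>H n\<^esub> x n)"
proof -
  have "inv\<^bsub>\<Delta>\<^esub> x = inv\<^bsub>product_group UNIV H\<^esub> x"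
    by (rule group.m_inv_consistent[OF _ subgroup assms]) (simp add: groups)
  then show ?thesis
    using subgroup.subset[OF subgroup] assms by (subst (asm) inv_product_group) (auto simp: groups)
qed

lemma conj_\<Delta>:
  "x \<in> D \<Longrightarrow> x \<otimes>\<^bsub>\<Delta>\<^esub> y \<otimes>\<^bsub>\<Delta>\<^esub> inv\<^bsub>\<Delta>\<^esub> x = (\<lambda>n. x n \<otimes>\<^bsub>H n\<^esub> y n \<otimes>\<^bsub>H n\<^esub> inv\<^bsub>H n\<^esub> x n)"
  unfolding mult_\<Delta> by (simp add: inv_\<Delta>)

definition embed :: "nat \<Rightarrow> 'b \<Rightarrow> nat \<Rightarrow> 'b" where
  "embed n h = (\<lambda>i. if i = n then h else \<one>\<^bsub>H i\<^esub>)"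

definition tail :: "nat \<Rightarrow> (nat \<Rightarrow> 'b) \<Rightarrow> nat \<Rightarrow> 'b" where
  "tail N x = (\<lambda>i. if i < N then \<one>\<^bsub>H i\<^esub> else x i)"

lemma one_closed_H [simp]: "\<one>\<^bsub>H n\<^esub> \<in> carrier (H n)"
  using groups by (simp add: group.is_monoid monoid.one_closed)

lemma embed_sum:
  assumes "h \<in> carrier (H n)"
  shows "embed n h \<in> carrier (sum_group UNIV H)"
proof -
  have "{i. embed n h i \<noteq> \<one>\<^bsub>H i\<^esub>} \<subseteq> {n}"
    by (auto simp: embed_def)
  then have "finite {i. embed n h i \<noteq> \<one>\<^bsub>H i\<^esub>}"
    using finite_subset by blast
  then show ?thesis
    using assms by (auto simp: sum_iff) (auto simp: embed_def)
qed

lemma embed_closed: "h \<in> carrier (H n) \<Longrightarrow> embed n h \<in> D"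
  using embed_sum sum_subset by blast

lemma embed_hom: "embed n \<in> hom (H n) \<Delta>"
proof (rule homI)
  show "embed n h \<in> carrier \<Delta>" if "h \<in> carrier (H n)" for h
    using embed_closed[OF that] by simp
  show "embed n (h \<otimes>\<^bsub>H n\<^esub> h') = embed n h \<otimes>\<^bsub>\<Delta>\<^esub> embed n h'" for h h'
    unfolding mult_\<Delta> using groups by (auto simp: embed_def group.is_monoid monoid.l_one)
qed

lemma inj_embed: "inj_on (embed n) A"
proof (rule inj_onI)
  fix x y assume "embed n x = embed n y"
  then have "embed n x n = embed n y n" by (rule fun_cong)
  then show "x = y" by (simp add: embed_def)
qed

lemma conj_embed:
  assumes "x \<in> D"
  shows "x \<otimes>\<^bsub>\<Delta>\<^esub> embed n h \<otimes>\<^bsub>\<Delta>\<^esub> inv\<^bsub>\<Delta>\<^esub> x = embed n (x n \<otimes>\<^bsub>H n\<^esub> h \<otimes>\<^bsub>H n\<^esub> inv\<^bsub>H n\<^esub> x n)"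
  using closed[OF assms] groups
  by (auto simp only: conj_\<Delta>[OF assms])
     (auto simp: embed_def fun_eq_iff group.is_monoid monoid.r_one group.r_inv)

text \<open>Conjugation by \<open>x\<close> sees only \<open>x n\<close>, and every element of
  \<open>H n\<close> occurs as such a coordinate. So the coordinate subgroups have finite classes
  even in an infinite group.\<close>

lemma conj_class_\<Delta>_embed:
  assumes "h \<in> carrier (H n)"
  shows "conj_class \<Delta> (embed n h) = embed n ` conj_class (H n) h"
proof -
  have "h \<in> (\<lambda>x. x n) ` D" if "h \<in> carrier (H n)" for h
    by (rule image_eqI[OF _ embed_closed[OF that]]) (simp add: embed_def)
  then have D_n: "carrier (H n) = (\<lambda>x. x n) ` D"
    using closed by blast
  have "conj_class (H n) h = (\<lambda>x. x n \<otimes>\<^bsub>H n\<^esub> h \<otimes>\<^bsub>H n\<^esub> inv\<^bsub>H n\<^esub> x n) ` D"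
    unfolding conj_class_def D_n by (simp only: image_image)
  then have "embed n ` conj_class (H n) h
      = (\<lambda>x. embed n (x n \<otimes>\<^bsub>H n\<^esub> h \<otimes>\<^bsub>H n\<^esub> inv\<^bsub>H n\<^esub> x n)) ` D"
    by (simp add: image_image)
  moreover have "conj_class \<Delta> (embed n h)
      = (\<lambda>x. embed n (x n \<otimes>\<^bsub>H n\<^esub> h \<otimes>\<^bsub>H n\<^esub> inv\<^bsub>H n\<^esub> x n)) ` D"
    unfolding conj_class_def by (rule image_cong) (simp, rule conj_embed)
  ultimately show ?thesis by simp
qed

lemma finite_conj_class_H: "h \<in> carrier (H n) \<Longrightarrow> finite (conj_class (H n) h)"
  by (simp add: conj_class_def finite_groups)

lemma tail_closed:
  assumes "x \<in> D"
  shows "tail N x \<in> D"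
proof -
  \<comment> \<open>\<open>x\<close> and its tail differ in finitely many coordinates, hence by an
    element of the direct sum.\<close>
  define y where "y i = (if i < N then inv\<^bsub>H i\<^esub> x i else \<one>\<^bsub>H i\<^esub>)" for i
  have "{i. y i \<noteq> \<one>\<^bsub>H i\<^esub>} \<subseteq> {..<N}" by (auto simp: y_def)
  then have "finite {i. y i \<noteq> \<one>\<^bsub>H i\<^esub>}" using finite_subset by blast
  moreover have "y i \<in> carrier (H i)" for i
    using closed[OF assms] groups by (simp add: y_def group.inv_closed)
  ultimately have "y \<in> D" using sum_subset by (auto simp: sum_iff)
  moreover have "tail N x = y \<otimes>\<^bsub>\<Delta>\<^esub> x"
    unfolding mult_\<Delta> tail_def y_def using closed[OF assms] groups
    by (auto simp: fun_eq_iff group.l_inv group.is_monoid monoid.l_one)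
  ultimately show ?thesis using assms \<Delta>.m_closed by simp
qed

lemma tail_hom: "tail N \<in> hom \<Delta> \<Delta>"
proof (rule homI)
  show "tail N (x \<otimes>\<^bsub>\<Delta>\<^esub> y) = tail N x \<otimes>\<^bsub>\<Delta>\<^esub> tail N y" for x y
    unfolding mult_\<Delta> using groups by (auto simp: tail_def fun_eq_iff group.is_monoid monoid.l_one)
qed (simp add: tail_closed)

lemma tail_0 [simp]: "tail 0 x = x"
  by (simp add: tail_def)

lemma tail_tail: "tail M (tail N x) = tail (max M N) x"
  by (auto simp: tail_def fun_eq_iff less_max_iff_disj)

lemma tail_Suc:
  assumes "x \<in> D"
  shows "tail N x = embed N (x N) \<otimes>\<^bsub>\<Delta>\<^esub> tail (Suc N) x"
  unfolding mult_\<Delta> using closed[OF assms] groups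
  by (auto simp: tail_def embed_def fun_eq_iff less_Suc_eq group.is_monoid monoid.l_one monoid.r_one)

section \<open>Traces and their coordinates\<close>

definition coordinate_trace :: "((nat \<Rightarrow> 'b) \<Rightarrow> complex) \<Rightarrow> nat \<Rightarrow> 'b \<Rightarrow> complex" where
  "coordinate_trace \<zeta> n = (\<lambda>h\<in>carrier (H n). \<zeta> (embed n h))"

lemma coordinate_trace_trace: "\<zeta> \<in> traces \<Delta> \<Longrightarrow> coordinate_trace \<zeta> n \<in> traces (H n)"
  unfolding coordinate_trace_def by (rule \<Delta>.trace_pullback[OF _ groups embed_hom])

text \<open>Extremality does not pass to subgroups in general. Here the class sum identity does,
  because a class of \<open>H n\<close> is also a class of the large group, and
  \<open>characterI\<close> turns it back into extremality.\<close>

lemma coordinate_trace_character: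
  assumes \<zeta>: "\<zeta> \<in> characters \<Delta>"
  shows "coordinate_trace \<zeta> n \<in> characters (H n)"
proof -
  interpret Hn: group "H n" by (rule groups)
  show ?thesis
  proof (rule Hn.characterI)
    show "coordinate_trace \<zeta> n \<in> traces (H n)"
      using \<zeta> by (intro coordinate_trace_trace charactersD)
  next
    fix h g assume h: "h \<in> carrier (H n)" and g: "g \<in> carrier (H n)"
    show "finite (conj_class (H n) h)" by (rule finite_conj_class_H[OF h])
    let ?C = "conj_class (H n) h"
    have C: "?C \<subseteq> carrier (H n)" by (rule Hn.conj_class_subset[OF h])
    have eh: "embed n h \<in> carrier \<Delta>" using embed_closed[OF h] by simp
    have "(\<Sum>y\<in>embed n ` ?C. \<zeta> (y \<otimes>\<^bsub>\<Delta>\<^esub> embed n g)) = (\<Sum>y\<in>embed n ` ?C. \<zeta> y) * \<zeta> (embed n g)"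
      unfolding conj_class_\<Delta>_embed[OF h, symmetric]
    proof (rule \<Delta>.character_class_sum[OF \<zeta>])
      show "finite (conj_class \<Delta> (embed n h))"
        by (simp only: conj_class_\<Delta>_embed[OF h] finite_imageI finite_conj_class_H[OF h])
      show "conj_class \<Delta> (embed n h) \<subseteq> carrier \<Delta>"
        by (rule \<Delta>.conj_class_subset[OF eh])
      show "x \<otimes>\<^bsub>\<Delta>\<^esub> y \<otimes>\<^bsub>\<Delta>\<^esub> inv\<^bsub>\<Delta>\<^esub> x \<in> conj_class \<Delta> (embed n h)"
        if "x \<in> carrier \<Delta>" "y \<in> conj_class \<Delta> (embed n h)" for x y
        by (rule \<Delta>.conj_class_conj[OF eh that])
    qed (use embed_closed[OF g] in simp)
    then have "(\<Sum>y\<in>?C. \<zeta> (embed n y \<otimes>\<^bsub>\<Delta>\<^esub> embed n g)) = (\<Sum>y\<in>?C. \<zeta> (embed n y)) * \<zeta> (embed n g)"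
      by (simp only: sum.reindex[OF inj_embed] o_def)
    moreover have "embed n y \<otimes>\<^bsub>\<Delta>\<^esub> embed n g = embed n (y \<otimes>\<^bsub>H n\<^esub> g)" if "y \<in> ?C" for y
      using hom_mult[OF embed_hom, of y n g] C that g by auto
    ultimately have "(\<Sum>y\<in>?C. \<zeta> (embed n (y \<otimes>\<^bsub>H n\<^esub> g))) = (\<Sum>y\<in>?C. \<zeta> (embed n y)) * \<zeta> (embed n g)"
      by (simp only: cong: sum.cong)
    moreover have "(\<Sum>y\<in>?C. coordinate_trace \<zeta> n (y \<otimes>\<^bsub>H n\<^esub> g)) = (\<Sum>y\<in>?C. \<zeta> (embed n (y \<otimes>\<^bsub>H n\<^esub> g)))"
      "(\<Sum>y\<in>?C. coordinate_trace \<zeta> n y) = (\<Sum>y\<in>?C. \<zeta> (embed n y))"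
      using C g by (auto simp: coordinate_trace_def intro!: sum.cong)
    ultimately show "(\<Sum>y\<in>?C. coordinate_trace \<zeta> n (y \<otimes>\<^bsub>H n\<^esub> g))
        = (\<Sum>y\<in>?C. coordinate_trace \<zeta> n y) * coordinate_trace \<zeta> n g"
      using g by (simp add: coordinate_trace_def)
  qed
qed

text \<open>A trace that restricts to a character on a coordinate kills the corresponding null vectors
  of the group algebra, hence is multiplicative over that coordinate without being extreme itself.\<close>

lemma trace_embed_mult:
  assumes \<zeta>: "\<zeta> \<in> traces \<Delta>" and \<phi>: "coordinate_trace \<zeta> n \<in> characters (H n)"
    and h: "h \<in> carrier (H n)" and g: "g \<in> D" "g n = \<one>\<^bsub>H n\<^esub>"
  shows "\<zeta> (embed n h \<otimes>\<^bsub>\<Delta>\<^esub> g) = coordinate_trace \<zeta> n h * \<zeta> g"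
proof -
  interpret Hn: group "H n" by (rule groups)
  let ?\<phi> = "coordinate_trace \<zeta> n"
  let ?C = "conj_class (H n) h"
  have C: "?C \<subseteq> carrier (H n)" by (rule Hn.conj_class_subset[OF h])
  have eC: "embed n ` ?C \<subseteq> carrier \<Delta>" using C embed_closed by auto
  have \<phi>_eq: "?\<phi> y = \<zeta> (embed n y)" if "y \<in> carrier (H n)" for y
    using that by (simp add: coordinate_trace_def)
  have \<zeta>': "positive_definite \<Delta> \<zeta>" "conjugation_invariant \<Delta> \<zeta>" "\<zeta> \<one>\<^bsub>\<Delta>\<^esub> = 1"
    using \<zeta> by (auto simp only: traces_iff)
  interpret e: group_hom "H n" \<Delta> "embed n"
    using embed_hom groups group_\<Delta> by (simp add: group_hom_def group_hom_axioms_def)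
  define b where "b = (\<Sum>y\<in>?C. ?\<phi> y)"
  have "(\<Sum>y\<in>?C. ?\<phi> (y \<otimes>\<^bsub>H n\<^esub> g)) = (\<Sum>y\<in>?C. ?\<phi> y) * ?\<phi> g" if "g \<in> carrier (H n)" for g
    by (rule Hn.character_class_sum[OF \<phi>])
       (use C that Hn.conj_class_conj[OF h] finite_conj_class_H[OF h] in auto)
  then have "class_defect (H n) ?C b ?\<phi> = 0"
    unfolding b_def by (intro Hn.class_defect_multiplicative charactersD(1)[OF \<phi>] C)
  moreover have "class_defect \<Delta> (embed n ` ?C) b \<zeta> = class_defect (H n) ?C b ?\<phi>"
  proof -
    have "(\<Sum>x\<in>?C. \<Sum>y\<in>?C. \<zeta> (inv\<^bsub>\<Delta>\<^esub> (embed n y) \<otimes>\<^bsub>\<Delta>\<^esub> embed n x))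
        = (\<Sum>x\<in>?C. \<Sum>y\<in>?C. ?\<phi> (inv\<^bsub>H n\<^esub> y \<otimes>\<^bsub>H n\<^esub> x))"
      using C by (intro sum.cong refl) (simp only: \<phi>_eq e.hom_mult e.hom_inv Hn.m_closed Hn.inv_closed subset_iff)
    moreover have "(\<Sum>y\<in>?C. \<zeta> (embed n y)) = (\<Sum>y\<in>?C. ?\<phi> y)"
      using C by (intro sum.cong refl) (simp only: \<phi>_eq subset_iff)
    moreover have "\<zeta> \<one>\<^bsub>\<Delta>\<^esub> = ?\<phi> \<one>\<^bsub>H n\<^esub>"
      by (simp only: \<phi>_eq Hn.one_closed e.hom_one)
    ultimately show ?thesis
      by (simp only: class_defect_def sum.reindex[OF inj_embed] o_def)
  qed
  ultimately have "(\<Sum>y\<in>embed n ` ?C. \<zeta> (y \<otimes>\<^bsub>\<Delta>\<^esub> g)) = b * \<zeta> g"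
    using finite_conj_class_H[OF h] g eC by (intro \<Delta>.class_defect_zero \<zeta>') auto
  then have "(\<Sum>y\<in>?C. \<zeta> (embed n y \<otimes>\<^bsub>\<Delta>\<^esub> g)) = b * \<zeta> g"
    by (simp only: sum.reindex[OF inj_embed] o_def)
  \<comment> \<open>As \<open>g\<close> is trivial at \<open>n\<close>, conjugation by
    \<open>embed n x\<close> fixes \<open>g\<close> and moves \<open>h\<close> through its class, so
    all summands coincide.\<close>
  moreover have "\<zeta> (embed n y \<otimes>\<^bsub>\<Delta>\<^esub> g) = \<zeta> (embed n h \<otimes>\<^bsub>\<Delta>\<^esub> g)" if y: "y \<in> ?C" for y
  proof -
    obtain x where x: "x \<in> carrier (H n)" "y = x \<otimes>\<^bsub>H n\<^esub> h \<otimes>\<^bsub>H n\<^esub> inv\<^bsub>H n\<^esub> x"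
      using y by (auto simp: conj_class_def)
    have ex: "embed n x \<in> D" and eh: "embed n h \<in> D" using embed_closed x(1) h by auto
    have "embed n y \<otimes>\<^bsub>\<Delta>\<^esub> g = embed n x \<otimes>\<^bsub>\<Delta>\<^esub> (embed n h \<otimes>\<^bsub>\<Delta>\<^esub> g) \<otimes>\<^bsub>\<Delta>\<^esub> inv\<^bsub>\<Delta>\<^esub> (embed n x)"
      unfolding conj_\<Delta>[OF ex] unfolding mult_\<Delta> using closed[OF g(1)] g(2) x h groups
      by (auto simp: embed_def fun_eq_iff group.is_monoid monoid.l_one monoid.r_one monoid.inv_one)
    then show ?thesis
      using conjugation_invariantD[OF \<zeta>'(2), of "embed n h \<otimes>\<^bsub>\<Delta>\<^esub> g" "embed n x"] ex eh g(1)
        \<Delta>.m_closed[of "embed n h" g] by (simp only:) simp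
  qed
  ultimately have "of_nat (card ?C) * \<zeta> (embed n h \<otimes>\<^bsub>\<Delta>\<^esub> g) = b * \<zeta> g"
    by simp
  moreover have "b = of_nat (card ?C) * ?\<phi> h"
    unfolding b_def using charactersD(1)[OF \<phi>] h by (intro Hn.sum_conj_class) (auto simp: traces_iff)
  moreover have "complex_of_nat (card ?C) \<noteq> 0"
    using Hn.conj_class_self[OF h] finite_conj_class_H[OF h] by auto
  ultimately show ?thesis by (simp add: mult.assoc)
qed

lemma trace_tail:
  assumes \<zeta>: "\<zeta> \<in> traces \<Delta>" and \<phi>: "\<And>n. coordinate_trace \<zeta> n \<in> characters (H n)" and g: "g \<in> D"
  shows "\<zeta> g = (\<Prod>i<N. coordinate_trace \<zeta> i (g i)) * \<zeta> (tail N g)"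
proof (induction N)
  case (Suc N)
  have "\<zeta> (tail N g) = coordinate_trace \<zeta> N (g N) * \<zeta> (tail (Suc N) g)"
    unfolding tail_Suc[OF g, of N]
    by (rule trace_embed_mult[OF \<zeta> \<phi> closed[OF g] tail_closed[OF g]]) (simp add: tail_def)
  with Suc show ?case by simp
qed simp

lemma trace_sum_group:
  assumes \<zeta>: "\<zeta> \<in> traces \<Delta>" and \<phi>: "\<And>n. coordinate_trace \<zeta> n \<in> characters (H n)"
    and g: "g \<in> carrier (sum_group UNIV H)"
  shows "\<zeta> g = tensor_character H (coordinate_trace \<zeta>) g"
proof -
  have fin: "finite {n. g n \<noteq> \<one>\<^bsub>H n\<^esub>}" and "g \<in> D"
    using g sum_subset by (auto simp: sum_iff)
  then obtain N where N: "{n. g n \<noteq> \<one>\<^bsub>H n\<^esub>} \<subseteq> {..<N}"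
    using finite_nat_iff_bounded by blast
  then have "tail N g = \<one>\<^bsub>\<Delta>\<^esub>"
    unfolding one_\<Delta> tail_def by (auto simp: fun_eq_iff)
  then have "\<zeta> g = (\<Prod>i<N. coordinate_trace \<zeta> i (g i))"
    using trace_tail[OF \<zeta> \<phi> \<open>g \<in> D\<close>, of N] \<zeta> by (simp only: traces_iff) simp
  also have "\<dots> = (\<Prod>i | g i \<noteq> \<one>\<^bsub>H i\<^esub>. coordinate_trace \<zeta> i (g i))"
    using N coordinate_trace_trace[OF \<zeta>] by (intro prod.mono_neutral_right) (auto simp: traces_iff)
  finally show ?thesis
    using g by (simp add: tensor_character_def)
qed

lemma restrict_sum_group_trace:
  assumes "\<zeta> \<in> traces \<Delta>"
  shows "restrict \<zeta> (carrier (sum_group UNIV H)) \<in> traces (sum_group UNIV H)"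
proof -
  have "(\<lambda>x. x) \<in> hom (sum_group UNIV H) \<Delta>"
    using sum_subset by (auto intro!: homI)
  then have "(\<lambda>x\<in>carrier (sum_group UNIV H). \<zeta> x) \<in> traces (sum_group UNIV H)"
    using assms groups by (intro \<Delta>.trace_pullback[where \<rho> = "\<lambda>x. x"]) auto
  then show ?thesis by (simp add: restrict_def)
qed

end

lemma sum_product_subgroup:
  assumes "\<And>n. group (H n)" "\<And>n. finite (carrier (H n))"
  shows "product_subgroup H (carrier (sum_group UNIV H))"
proof (rule product_subgroup.intro)
  have "carrier (sum_group UNIV H) = {x \<in> \<Pi>\<^sub>E i\<in>UNIV. carrier (H i). finite {i \<in> UNIV. x i \<noteq> \<one>\<^bsub>H i\<^esub>}}"
    by (rule carrier_sum_group) (use assms in auto)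
  then show "subgroup (carrier (sum_group UNIV H)) (product_group UNIV H)"
    using subgroup_sum_group[of UNIV H] assms by simp
qed (use assms in auto)

lemma sum_group_eq:
  "(product_group UNIV H)\<lparr>carrier := carrier (sum_group UNIV H)\<rparr> = sum_group UNIV H"
  by (simp add: sum_group_def subgroup_generated_def)

text \<open>A trace on the direct sum is determined by its coordinates once these are characters. A
  convex decomposition of the restriction is trivial in every coordinate, hence trivial.\<close>

lemma (in product_subgroup) restrict_sum_group_character:
  assumes \<zeta>: "\<zeta> \<in> characters \<Delta>"
  shows "restrict \<zeta> (carrier (sum_group UNIV H)) \<in> characters (sum_group UNIV H)"
proof -
  let ?U = "sum_group UNIV H"
  interpret U: product_subgroup H "carrier ?U"
    by (rule sum_product_subgroup) (rule groups finite_groups)+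
  note U_eq = sum_group_eq[of H]
  have \<zeta>t: "\<zeta> \<in> traces \<Delta>" by (rule charactersD(1)[OF \<zeta>])
  have "\<alpha> = \<beta>" if \<alpha>: "\<alpha> \<in> traces ?U" and \<beta>: "\<beta> \<in> traces ?U" and u: "0 < u" "u < 1"
    and eq: "\<And>g. g \<in> carrier ?U \<Longrightarrow> restrict \<zeta> (carrier ?U) g = of_real u * \<alpha> g + of_real (1 - u) * \<beta> g"
    for \<alpha> \<beta> u
  proof -
    have \<alpha>': "\<alpha> \<in> traces U.\<Delta>" and \<beta>': "\<beta> \<in> traces U.\<Delta>"
      using \<alpha> \<beta> by (simp_all only: U_eq)
    have ct: "coordinate_trace \<alpha> n = coordinate_trace \<beta> n \<and> coordinate_trace \<alpha> n \<in> characters (H n)" for n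
    proof -
      have 1: "coordinate_trace \<alpha> n \<in> traces (H n)" "coordinate_trace \<beta> n \<in> traces (H n)"
        using U.coordinate_trace_trace[OF \<alpha>'] U.coordinate_trace_trace[OF \<beta>'] .
      have 2: "coordinate_trace \<zeta> n h = of_real u * coordinate_trace \<alpha> n h + of_real (1 - u) * coordinate_trace \<beta> n h"
        if "h \<in> carrier (H n)" for h
        using eq[OF embed_sum[OF that]] embed_sum[OF that] that
        by (simp add: coordinate_trace_def)
      have eq': "coordinate_trace \<alpha> n = coordinate_trace \<beta> n"
        by (rule charactersD(2)[OF coordinate_trace_character[OF \<zeta>] 1 u 2])
      have "coordinate_trace \<zeta> n = coordinate_trace \<alpha> n"
      proof
        show "coordinate_trace \<zeta> n h = coordinate_trace \<alpha> n h" for h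
          using 2[of h] fun_cong[OF eq', of h] by (cases "h \<in> carrier (H n)")
            (auto simp: coordinate_trace_def algebra_simps)
      qed
      then show ?thesis
        using eq' coordinate_trace_character[OF \<zeta>, of n] by simp
    qed
    have ct\<alpha>: "coordinate_trace \<alpha> n \<in> characters (H n)" for n
      using ct by blast
    have ct\<beta>: "coordinate_trace \<beta> n \<in> characters (H n)" for n
      by (rule subst[where P = "\<lambda>f. f \<in> characters (H n)", OF conjunct1[OF ct] conjunct2[OF ct]])
    show ?thesis
    proof
      fix g
      show "\<alpha> g = \<beta> g"
      proof (cases "g \<in> carrier ?U")
        case True
        have "\<alpha> g = tensor_character H (coordinate_trace \<alpha>) g"
          using U.trace_sum_group[OF \<alpha>' ct\<alpha> True] .
        moreover have "\<beta> g = tensor_character H (coordinate_trace \<beta>) g"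
          using U.trace_sum_group[OF \<beta>' ct\<beta> True] .
        moreover have "coordinate_trace \<alpha> = coordinate_trace \<beta>"
          by (rule ext, rule conjunct1[OF ct])
        ultimately show ?thesis by simp
      next
        case False
        then show ?thesis using \<alpha> \<beta> by (auto simp: traces_iff extensional_def)
      qed
    qed
  qed
  then show ?thesis
    unfolding characters_def extreme_functions_def using restrict_sum_group_trace[OF \<zeta>t] by blast
qed

section \<open>The diagonal product\<close>

text \<open>Countability of the diagonal product is what allows one subsequence to converge at all
  of its elements.\<close>

lemma (in group) countable_generate:
  assumes A: "countable A" "A \<subseteq> carrier G"
  shows "countable (generate G A)"
proof -
  let ?B = "A \<union> m_inv G ` A" and ?p = "\<lambda>l. foldr (\<otimes>) l \<one>"
  have p_closed: "?p l \<in> carrier G" if "l \<in> lists ?B" for l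
    using that A(2) by (induction l) auto
  have p_append: "?p (k @ l) = ?p k \<otimes> ?p l" if "k \<in> lists ?B" "l \<in> lists ?B" for k l
    using that(1)
  proof (induction k)
    case (Cons a k)
    then have "a \<in> carrier G" using A(2) by auto
    moreover have "?p k \<in> carrier G" "?p l \<in> carrier G" using p_closed Cons that(2) by auto
    ultimately show ?case using Cons by (simp add: m_assoc)
  qed (use p_closed[OF that(2)] in simp)
  have "g \<in> ?p ` lists ?B" if "g \<in> generate G A" for g
    using that
  proof induction
    case one
    show ?case by (rule image_eqI[of _ _ "[]"]) auto
  next
    case (incl h)
    then show ?case using A(2) by (intro image_eqI[of _ _ "[h]"]) auto
  next
    case (inv h)
    then show ?case using A(2) by (intro image_eqI[of _ _ "[inv h]"]) auto
  next
    case (eng g h)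
    then obtain k l where "k \<in> lists ?B" "l \<in> lists ?B" "g = ?p k" "h = ?p l" by blast
    then show ?case by (intro image_eqI[of _ _ "k @ l"]) (simp_all only: p_append append_in_lists_conv simp_thms)
  qed
  then have "generate G A \<subseteq> ?p ` lists ?B" by blast
  moreover have "countable (?p ` lists ?B)" using A(1) by auto
  ultimately show ?thesis by (rule countable_subset)
qed

locale diagonal_lef = group G for G :: "('a, 'm) monoid_scheme" (structure) +
  fixes S :: "'a set"
    and H :: "nat \<Rightarrow> ('b, 'k) monoid_scheme"
    and \<theta> :: "nat \<Rightarrow> 'a \<Rightarrow> 'b"
  assumes finite_S: "finite S" and S_subset: "S \<subseteq> carrier G" and generate_S: "generate G S = carrier G"
    and lef: "lef_approximation G H \<theta>"
    and essential: "essential_by_simple_groups G S H \<theta>"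
begin

lemma group_H: "group (H n)" and finite_H: "finite (carrier (H n))"
  and \<theta>_closed: "\<tau> \<in> carrier G \<Longrightarrow> \<theta> n \<tau> \<in> carrier (H n)"
  and \<theta>_mult: "\<lbrakk>\<tau> \<in> carrier G; \<sigma> \<in> carrier G\<rbrakk> \<Longrightarrow>
    \<forall>\<^sub>F n in sequentially. \<theta> n (\<tau> \<otimes> \<sigma>) = \<theta> n \<tau> \<otimes>\<^bsub>H n\<^esub> \<theta> n \<sigma>"
  and \<theta>_faithful: "\<lbrakk>\<tau> \<in> carrier G; \<tau> \<noteq> \<one>\<rbrakk> \<Longrightarrow> \<forall>\<^sub>F n in sequentially. \<theta> n \<tau> \<noteq> \<one>\<^bsub>H n\<^esub>"
  using lef by (auto simp: lef_approximation_def)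

lemma simple_H: "simple_group (H n)" and not_iso_H: "m \<noteq> n \<Longrightarrow> \<not> H m \<cong> H n"
  and not_hom: "f \<in> hom G (H n) \<Longrightarrow> \<exists>s\<in>S. f s \<noteq> \<theta> n s"
  and generate_H: "generate (H n) (\<theta> n ` S) = carrier (H n)"
  using essential by (auto simp: essential_by_simple_groups_def)

sublocale H: group "H n" for n
  by (rule group_H)

abbreviation P :: "(nat \<Rightarrow> 'b) monoid" where "P \<equiv> product_group UNIV H"

sublocale P: group P
  by simp

definition gens :: "(nat \<Rightarrow> 'b) set" where "gens = (\<lambda>s. (\<lambda>n. \<theta> n s)) ` S"

definition D :: "(nat \<Rightarrow> 'b) set" where "D = generate P gens"

lemma gens_subset: "gens \<subseteq> carrier P"
  using S_subset by (auto simp: gens_def \<theta>_closed PiE_iff)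

lemma diagonal_product_eq: "diagonal_product S H \<theta> = P\<lparr>carrier := D\<rparr>"
proof -
  have "carrier P \<inter> gens = gens" using gens_subset by blast
  then show ?thesis by (simp only: diagonal_product_def subgroup_generated_def D_def flip: gens_def)
qed

lemma subgroup_D: "subgroup D P"
  unfolding D_def by (rule P.generate_is_subgroup[OF gens_subset])

lemma countable_D: "countable D"
  unfolding D_def by (rule P.countable_generate[OF _ gens_subset]) (simp add: gens_def finite_S countable_finite)

lemma D_closed: "x \<in> D \<Longrightarrow> x n \<in> carrier (H n)"
  using subgroup.subset[OF subgroup_D] by (auto simp: PiE_iff)

lemma one_D: "(\<lambda>n. \<one>\<^bsub>H n\<^esub>) \<in> D"
  using subgroup.one_closed[OF subgroup_D] by (simp add: restrict_def)

lemma mult_D: "x \<in> D \<Longrightarrow> y \<in> D \<Longrightarrow> (\<lambda>n. x n \<otimes>\<^bsub>H n\<^esub> y n) \<in> D"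
  using subgroup.m_closed[OF subgroup_D] by (simp add: restrict_def)

lemma inv_P: "x \<in> carrier P \<Longrightarrow> inv\<^bsub>P\<^esub> x = (\<lambda>n. inv\<^bsub>H n\<^esub> x n)"
  by (subst inv_product_group) auto

lemma inv_D: "x \<in> D \<Longrightarrow> (\<lambda>n. inv\<^bsub>H n\<^esub> x n) \<in> D"
  using subgroup.m_inv_closed[OF subgroup_D] subgroup.subset[OF subgroup_D] inv_P by (metis subsetD)

lemma gen_D: "s \<in> S \<Longrightarrow> (\<lambda>n. \<theta> n s) \<in> D"
  unfolding D_def by (rule generate.incl) (auto simp: gens_def)

lemma D_induct [consumes 1, case_names one gen inv mult]:
  assumes "x \<in> D" and "Q (\<lambda>n. \<one>\<^bsub>H n\<^esub>)" and "\<And>s. s \<in> S \<Longrightarrow> Q (\<lambda>n. \<theta> n s)"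
    and "\<And>s. s \<in> S \<Longrightarrow> Q (\<lambda>n. inv\<^bsub>H n\<^esub> (\<theta> n s))"
    and "\<And>x y. x \<in> D \<Longrightarrow> y \<in> D \<Longrightarrow> Q x \<Longrightarrow> Q y \<Longrightarrow> Q (\<lambda>n. x n \<otimes>\<^bsub>H n\<^esub> y n)"
  shows "Q x"
  using assms(1) unfolding D_def
proof induction
  case one
  then show ?case using assms(2) by (simp add: restrict_def)
next
  case (incl h)
  then show ?case using assms(3) by (auto simp: gens_def)
next
  case (inv h)
  then show ?case using assms(4) gens_subset by (subst inv_P) (auto simp: gens_def)
next
  case (eng x y)
  then show ?case using assms(5)[of x y] by (simp add: D_def restrict_def)
qed

lemma D_coordinate: "h \<in> carrier (H n) \<Longrightarrow> \<exists>x\<in>D. x n = h"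
proof -
  assume h: "h \<in> carrier (H n)"
  interpret p: group_hom P "H n" "\<lambda>x. x n"
    by (simp add: group_hom_def group_hom_axioms_def group_H hom_def PiE_iff)
  have "(\<lambda>x. x n) ` gens = \<theta> n ` S" by (simp add: gens_def image_image)
  then have "(\<lambda>x. x n) ` D = carrier (H n)"
    unfolding D_def using p.generate_img[OF gens_subset] generate_H by simp
  then have "h \<in> (\<lambda>x. x n) ` D" using h by simp
  then show ?thesis by auto
qed

text \<open>The tail map as a relation, available before existence and uniqueness of
  \<open>\<tau>\<close> are known. The maps \<open>\<theta> n\<close> are multiplicative only
  asymptotically, so agreement is asked from some index on.\<close>

definition follows :: "(nat \<Rightarrow> 'b) \<Rightarrow> 'a \<Rightarrow> bool" where
  "follows x \<tau> \<longleftrightarrow> \<tau> \<in> carrier G \<and> (\<forall>\<^sub>F n in sequentially. x n = \<theta> n \<tau>)"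

lemma follows_closed: "follows x \<tau> \<Longrightarrow> \<tau> \<in> carrier G"
  by (simp add: follows_def)

lemma follows_mult:
  assumes "follows x \<tau>" "follows y \<sigma>"
  shows "follows (\<lambda>n. x n \<otimes>\<^bsub>H n\<^esub> y n) (\<tau> \<otimes> \<sigma>)"
proof -
  have "\<forall>\<^sub>F n in sequentially. x n = \<theta> n \<tau>" "\<forall>\<^sub>F n in sequentially. y n = \<theta> n \<sigma>"
    "\<forall>\<^sub>F n in sequentially. \<theta> n (\<tau> \<otimes> \<sigma>) = \<theta> n \<tau> \<otimes>\<^bsub>H n\<^esub> \<theta> n \<sigma>"
    using assms \<theta>_mult by (auto simp: follows_def)
  then have "\<forall>\<^sub>F n in sequentially. x n \<otimes>\<^bsub>H n\<^esub> y n = \<theta> n (\<tau> \<otimes> \<sigma>)"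
    by eventually_elim simp
  then show ?thesis using assms by (simp add: follows_def)
qed

lemma follows_one: "follows (\<lambda>n. \<one>\<^bsub>H n\<^esub>) \<one>"
proof -
  have "\<forall>\<^sub>F n in sequentially. \<theta> n (\<one> \<otimes> \<one>) = \<theta> n \<one> \<otimes>\<^bsub>H n\<^esub> \<theta> n \<one>"
    by (rule \<theta>_mult) auto
  then have "\<forall>\<^sub>F n in sequentially. \<one>\<^bsub>H n\<^esub> = \<theta> n \<one>"
  proof eventually_elim
    case (elim n)
    \<comment> \<open>\<open>\<theta> n \<one>\<close> is an idempotent of a group.\<close>
    then show ?case using H.one_unique[of "\<theta> n \<one>"] \<theta>_closed[OF one_closed]
      by (metis H.r_cancel_one' l_one one_closed)
  qed
  then show ?thesis by (simp add: follows_def)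
qed

lemma follows_inv:
  assumes "follows x \<tau>"
  shows "follows (\<lambda>n. inv\<^bsub>H n\<^esub> x n) (inv \<tau>)"
proof -
  have \<tau>: "\<tau> \<in> carrier G" by (rule follows_closed[OF assms])
  have "\<forall>\<^sub>F n in sequentially. x n = \<theta> n \<tau>" "\<forall>\<^sub>F n in sequentially. \<one>\<^bsub>H n\<^esub> = \<theta> n \<one>"
    "\<forall>\<^sub>F n in sequentially. \<theta> n (inv \<tau> \<otimes> \<tau>) = \<theta> n (inv \<tau>) \<otimes>\<^bsub>H n\<^esub> \<theta> n \<tau>"
    using assms follows_one \<theta>_mult[OF inv_closed[OF \<tau>] \<tau>] by (simp_all only: follows_def)
  then have "\<forall>\<^sub>F n in sequentially. inv\<^bsub>H n\<^esub> x n = \<theta> n (inv \<tau>)"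
  proof eventually_elim
    case (elim n)
    then show ?case
      using H.inv_equality[of n "\<theta> n (inv \<tau>)" "\<theta> n \<tau>"] \<tau> \<theta>_closed by simp
  qed
  then show ?thesis using \<tau> by (simp add: follows_def)
qed

text \<open>Otherwise the trivial sequence would follow the nontrivial element
  \<open>\<tau> \<otimes> inv \<sigma>\<close>, against asymptotic injectivity.\<close>

lemma follows_unique:
  assumes "follows x \<tau>" "follows x \<sigma>"
  shows "\<tau> = \<sigma>"
proof (rule ccontr)
  assume "\<tau> \<noteq> \<sigma>"
  moreover have \<tau>\<sigma>: "\<tau> \<in> carrier G" "\<sigma> \<in> carrier G" using assms by (auto simp: follows_def)
  ultimately have ne: "\<tau> \<otimes> inv \<sigma> \<noteq> \<one>"
    using inv_equality[of \<tau> "inv \<sigma>"] by auto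
  have "\<forall>\<^sub>F n in sequentially. x n \<otimes>\<^bsub>H n\<^esub> inv\<^bsub>H n\<^esub> x n = \<theta> n (\<tau> \<otimes> inv \<sigma>)"
    using follows_mult[OF assms(1) follows_inv[OF assms(2)]] by (simp add: follows_def)
  moreover have "\<forall>\<^sub>F n in sequentially. x n = \<theta> n \<tau>" using assms by (simp add: follows_def)
  moreover have "\<forall>\<^sub>F n in sequentially. \<theta> n (\<tau> \<otimes> inv \<sigma>) \<noteq> \<one>\<^bsub>H n\<^esub>"
    by (rule \<theta>_faithful[OF _ ne]) (use \<tau>\<sigma> in auto)
  ultimately have "\<forall>\<^sub>F n in sequentially. False"
    by eventually_elim (use \<theta>_closed[OF \<tau>\<sigma>(1)] in simp)
  then show False by simp
qed

lemma follows_cong: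
  assumes "follows x \<tau>" "\<forall>\<^sub>F n in sequentially. x n = y n"
  shows "follows y \<tau>"
proof -
  have "\<forall>\<^sub>F n in sequentially. x n = \<theta> n \<tau>" using assms by (simp add: follows_def)
  with assms(2) have "\<forall>\<^sub>F n in sequentially. y n = \<theta> n \<tau>" by eventually_elim simp
  then show ?thesis using assms by (simp add: follows_def)
qed

lemma follows_gen: "s \<in> S \<Longrightarrow> follows (\<lambda>n. \<theta> n s) s"
  using S_subset by (auto simp: follows_def)

lemma ex_follows: "x \<in> D \<Longrightarrow> \<exists>\<tau>. follows x \<tau>"
proof (induction rule: D_induct)
  case one
  show ?case by (rule exI, rule follows_one)
next
  case (gen s)
  then show ?case by (intro exI) (rule follows_gen)
next
  case (inv s)
  then show ?case by (intro exI) (rule follows_inv[OF follows_gen])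
next
  case (mult x y)
  then obtain \<tau> \<sigma> where "follows x \<tau>" "follows y \<sigma>" by auto
  then show ?case by (intro exI) (rule follows_mult)
qed

lemma ex_lift: "\<tau> \<in> carrier G \<Longrightarrow> \<exists>x\<in>D. follows x \<tau>"
  unfolding generate_S[symmetric]
proof (induction rule: generate.induct)
  case one
  show ?case using one_D follows_one by blast
next
  case (incl h)
  then show ?case using gen_D follows_gen by blast
next
  case (inv h)
  then show ?case using inv_D[OF gen_D] follows_inv[OF follows_gen] by blast
next
  case (eng g h)
  then show ?case using mult_D follows_mult by blast
qed

section \<open>The direct sum inside the diagonal product\<close>

definition supported :: "nat set \<Rightarrow> (nat \<Rightarrow> 'b) set" where
  "supported F = {x \<in> D. \<forall>i. i \<notin> F \<longrightarrow> x i = \<one>\<^bsub>H i\<^esub>}"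

lemma supported_D: "x \<in> supported F \<Longrightarrow> x \<in> D"
  by (simp add: supported_def)

lemma supported_mult:
  "x \<in> supported F \<Longrightarrow> y \<in> supported F \<Longrightarrow> (\<lambda>n. x n \<otimes>\<^bsub>H n\<^esub> y n) \<in> supported F"
  by (simp add: supported_def mult_D)

lemma supported_inv: "x \<in> supported F \<Longrightarrow> (\<lambda>n. inv\<^bsub>H n\<^esub> x n) \<in> supported F"
  by (simp add: supported_def inv_D)

lemma supported_conj:
  assumes "x \<in> supported F" "y \<in> D"
  shows "(\<lambda>n. y n \<otimes>\<^bsub>H n\<^esub> x n \<otimes>\<^bsub>H n\<^esub> inv\<^bsub>H n\<^esub> y n) \<in> supported F"
  using assms mult_D[OF mult_D[OF assms(2) supported_D[OF assms(1)]] inv_D[OF assms(2)]]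
    D_closed[OF assms(2)] by (simp add: supported_def)

text \<open>The values at \<open>k\<close> of elements supported in \<open>F\<close> form a subgroup
  of \<open>H k\<close>. It is normal because \<open>D\<close> projects onto \<open>H k\<close>, so
  simplicity leaves only all of \<open>H k\<close>.\<close>

lemma supported_coordinate:
  assumes x: "x \<in> supported F" "x k \<noteq> \<one>\<^bsub>H k\<^esub>" and h: "h \<in> carrier (H k)"
  shows "\<exists>y\<in>supported F. y k = h"
proof -
  let ?N = "(\<lambda>x. x k) ` supported F"
  have "?N \<lhd> H k"
  proof (rule H.normal_invI)
    show "subgroup ?N (H k)"
    proof (rule H.subgroupI)
      show "?N \<subseteq> carrier (H k)" using D_closed by (auto simp: supported_def)
      show "?N \<noteq> {}" using x by auto
      show "inv\<^bsub>H k\<^esub> a \<in> ?N" if "a \<in> ?N" for a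
        using that supported_inv by (force simp: image_iff)
      show "a \<otimes>\<^bsub>H k\<^esub> b \<in> ?N" if ab: "a \<in> ?N" "b \<in> ?N" for a b
      proof -
        obtain y where "a = y k" "y \<in> supported F" using ab(1) by (rule imageE)
        moreover obtain z where "b = z k" "z \<in> supported F" using ab(2) by (rule imageE)
        ultimately show ?thesis using supported_mult[of y F z]
          by (intro image_eqI[where x = "\<lambda>n. y n \<otimes>\<^bsub>H n\<^esub> z n"]) auto
      qed
    qed
    show "a \<otimes>\<^bsub>H k\<^esub> b \<otimes>\<^bsub>H k\<^esub> inv\<^bsub>H k\<^esub> a \<in> ?N" if ab: "a \<in> carrier (H k)" "b \<in> ?N" for a b
    proof -
      obtain y where "y \<in> D" "a = y k" using D_coordinate[OF ab(1)] by auto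
      moreover obtain z where "b = z k" "z \<in> supported F" using ab(2) by (rule imageE)
      ultimately show ?thesis using supported_conj[of z F y]
        by (intro image_eqI[where x = "\<lambda>n. y n \<otimes>\<^bsub>H n\<^esub> z n \<otimes>\<^bsub>H n\<^esub> inv\<^bsub>H n\<^esub> y n"]) auto
    qed
  qed
  then have "?N = carrier (H k) \<or> ?N = {\<one>\<^bsub>H k\<^esub>}"
    by (rule simple_group.no_real_normal_subgroup[OF simple_H])
  then have "?N = carrier (H k)" using x by auto
  then have "h \<in> ?N" using h by simp
  then show ?thesis by auto
qed

text \<open>If all finitely supported elements were trivial at \<open>n\<close>, coordinate
  \<open>n\<close> of \<open>x\<close> would depend only on the element that \<open>x\<close>
  follows. That dependence is a homomorphism extending \<open>\<theta> n\<close> on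
  \<open>S\<close>, which essentiality excludes.\<close>

lemma ex_finite_support:
  "\<exists>x\<in>D. finite {i. x i \<noteq> \<one>\<^bsub>H i\<^esub>} \<and> x n \<noteq> \<one>\<^bsub>H n\<^esub>"
proof (rule ccontr)
  assume "\<not> ?thesis"
  then have none: "x n = \<one>\<^bsub>H n\<^esub>" if "x \<in> D" "finite {i. x i \<noteq> \<one>\<^bsub>H i\<^esub>}" for x
    using that by blast
  \<comment> \<open>Elements following the same \<open>\<tau>\<close> have a finitely supported
    quotient, trivial at \<open>n\<close> by assumption.\<close>
  have same: "x n = y n" if xy: "x \<in> D" "y \<in> D" and f: "follows x \<tau>" "follows y \<tau>" for x y \<tau>
  proof -
    let ?z = "\<lambda>i. x i \<otimes>\<^bsub>H i\<^esub> inv\<^bsub>H i\<^esub> y i"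
    have "\<forall>\<^sub>F i in sequentially. x i = \<theta> i \<tau>" "\<forall>\<^sub>F i in sequentially. y i = \<theta> i \<tau>"
      using f by (auto simp: follows_def)
    then have "\<forall>\<^sub>F i in sequentially. ?z i = \<one>\<^bsub>H i\<^esub>"
      by eventually_elim (use \<theta>_closed f(1) in \<open>simp add: follows_def\<close>)
    then have "finite {i. ?z i \<noteq> \<one>\<^bsub>H i\<^esub>}"
      by (simp add: eventually_cofinite flip: cofinite_eq_sequentially)
    then have "?z n = \<one>\<^bsub>H n\<^esub>"
      using none[of ?z] mult_D[OF xy(1) inv_D[OF xy(2)]] by blast
    then show ?thesis
      using H.inv_equality[of n "x n" "inv\<^bsub>H n\<^esub> y n"] D_closed xy by simp
  qed
  define f where "f \<tau> = (SOME x. x \<in> D \<and> follows x \<tau>) n" for \<tau>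
  have f_eq: "f \<tau> = x n" if "x \<in> D" "follows x \<tau>" for x \<tau>
  proof -
    have "(SOME x. x \<in> D \<and> follows x \<tau>) \<in> D \<and> follows (SOME x. x \<in> D \<and> follows x \<tau>) \<tau>"
      by (rule someI[of _ x]) (use that in blast)
    then show ?thesis unfolding f_def using same that by blast
  qed
  have "f \<in> hom G (H n)"
  proof (rule homI)
    fix \<tau> assume "\<tau> \<in> carrier G"
    then obtain x where x: "x \<in> D" "follows x \<tau>" using ex_lift by blast
    then show "f \<tau> \<in> carrier (H n)" using f_eq D_closed by simp
    fix \<sigma> assume "\<sigma> \<in> carrier G"
    then obtain y where y: "y \<in> D" "follows y \<sigma>" using ex_lift by blast
    show "f (\<tau> \<otimes> \<sigma>) = f \<tau> \<otimes>\<^bsub>H n\<^esub> f \<sigma>"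
      using f_eq[OF x] f_eq[OF y] f_eq[OF mult_D[OF x(1) y(1)] follows_mult[OF x(2) y(2)]] by simp
  qed
  then show False
    using not_hom f_eq[OF gen_D follows_gen] by blast
qed

text \<open>If the support of \<open>x\<close> is minimal among those containing \<open>n\<close> and contains \<open>m \<noteq> n\<close>, then within
  that support each of the coordinates \<open>m\<close> and \<open>n\<close> determines the other, so \<open>H m \<cong> H n\<close>.\<close>

lemma supported_single:
  assumes h: "h \<in> carrier (H n)"
  shows "(\<lambda>i. if i = n then h else \<one>\<^bsub>H i\<^esub>) \<in> D"
proof -
  let ?supp = "\<lambda>x. {i. x i \<noteq> \<one>\<^bsub>H i\<^esub>}"
  let ?Q = "\<lambda>x. x \<in> D \<and> finite (?supp x) \<and> x n \<noteq> \<one>\<^bsub>H n\<^esub>"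
  obtain x where x: "?Q x" and least: "\<And>y. ?Q y \<Longrightarrow> card (?supp x) \<le> card (?supp y)"
    using ex_finite_support[of n] ex_has_least_nat[of ?Q _ "\<lambda>x. card (?supp x)"] by blast
  define F where "F = ?supp x"
  have F: "finite F" "n \<in> F" using x by (auto simp: F_def)
  have xF: "x \<in> supported F" using x by (auto simp: supported_def F_def)
  have full: "d m \<noteq> \<one>\<^bsub>H m\<^esub>" if d: "d \<in> supported F" "d n \<noteq> \<one>\<^bsub>H n\<^esub>" and m: "m \<in> F" for d m
  proof
    assume "d m = \<one>\<^bsub>H m\<^esub>"
    then have "?supp d \<subset> F" using d m by (auto simp: supported_def)
    then have "card (?supp d) < card F" "finite (?supp d)"
      using F by (auto intro: psubset_card_mono finite_subset)
    then show False using least[of d] d supported_D by (simp add: F_def)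
  qed
  have "F = {n}"
  proof (rule ccontr)
    assume "F \<noteq> {n}"
    then obtain m where m: "m \<in> F" "m \<noteq> n" using F by blast
    \<comment> \<open>If \<open>d\<close> were nontrivial at \<open>m\<close>, simplicity would
      supply an \<open>a\<close>, trivial at \<open>n\<close>, with \<open>a m = x m\<close>; then
      \<open>x\<close> times the inverse of \<open>a\<close> keeps coordinate \<open>n\<close> and
      loses \<open>m\<close>, against minimality.\<close>
    have dn: "d m = \<one>\<^bsub>H m\<^esub>" if d: "d \<in> supported F" "d n = \<one>\<^bsub>H n\<^esub>" for d
    proof (rule ccontr)
      assume "d m \<noteq> \<one>\<^bsub>H m\<^esub>"
      moreover have "d \<in> supported (F - {n})" using d by (auto simp: supported_def)
      ultimately obtain a where a: "a \<in> supported (F - {n})" "a m = x m"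
        using supported_coordinate D_closed x by blast
      let ?z = "\<lambda>i. x i \<otimes>\<^bsub>H i\<^esub> inv\<^bsub>H i\<^esub> a i"
      have "a \<in> supported F" "a n = \<one>\<^bsub>H n\<^esub>" using a by (auto simp: supported_def)
      then have "?z \<in> supported F" "?z n \<noteq> \<one>\<^bsub>H n\<^esub>" "?z m = \<one>\<^bsub>H m\<^esub>"
        using supported_mult[OF xF supported_inv] x D_closed a by auto
      then show False using full m by blast
    qed
    have same: "c m = d m \<longleftrightarrow> c n = d n" if cd: "c \<in> supported F" "d \<in> supported F" for c d
    proof -
      let ?z = "\<lambda>i. c i \<otimes>\<^bsub>H i\<^esub> inv\<^bsub>H i\<^esub> d i"
      have "?z \<in> supported F" using supported_mult[OF _ supported_inv] cd by simp
      then have "?z m = \<one>\<^bsub>H m\<^esub> \<longleftrightarrow> ?z n = \<one>\<^bsub>H n\<^esub>" using dn full m(1) by blast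
      moreover have "?z i = \<one>\<^bsub>H i\<^esub> \<longleftrightarrow> c i = d i" for i
        using H.inv_equality[of i "c i" "inv\<^bsub>H i\<^esub> d i"] D_closed cd supported_D by auto
      ultimately show ?thesis by simp
    qed
    have xm: "x m \<noteq> \<one>\<^bsub>H m\<^esub>" using m by (simp add: F_def)
    have "\<exists>c. c \<in> supported F \<and> c m = a" if "a \<in> carrier (H m)" for a
      using supported_coordinate[OF xF xm that] by blast
    \<comment> \<open>\<open>c\<close> is a section of coordinate \<open>m\<close> on the elements
      supported in \<open>F\<close>; followed by coordinate \<open>n\<close> it becomes the
      isomorphism.\<close>
    then obtain c where c: "\<And>a. a \<in> carrier (H m) \<Longrightarrow> c a \<in> supported F \<and> c a m = a"
      by metis
    have c_eq: "c (d m) n = d n" if "d \<in> supported F" for d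
      using c[of "d m"] same[of "c (d m)" d] that D_closed supported_D by blast
    have "(\<lambda>a. c a n) \<in> iso (H m) (H n)"
    proof (rule isoI)
      show "(\<lambda>a. c a n) \<in> hom (H m) (H n)"
      proof (rule homI)
        show "c a n \<in> carrier (H n)" if "a \<in> carrier (H m)" for a
          using c[OF that] D_closed supported_D by blast
        show "c (a \<otimes>\<^bsub>H m\<^esub> b) n = c a n \<otimes>\<^bsub>H n\<^esub> c b n" if "a \<in> carrier (H m)" "b \<in> carrier (H m)" for a b
          using c[OF that(1)] c[OF that(2)] c_eq[OF supported_mult[of "c a" F "c b"]] by simp
      qed
      show "bij_betw (\<lambda>a. c a n) (carrier (H m)) (carrier (H n))"
      proof (rule bij_betw_imageI)
        show "inj_on (\<lambda>a. c a n) (carrier (H m))"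
        proof (rule inj_onI)
          fix a b assume ab: "a \<in> carrier (H m)" "b \<in> carrier (H m)" and "c a n = c b n"
          then have "c a m = c b m" using same[of "c a" "c b"] c by blast
          then show "a = b" using c[OF ab(1)] c[OF ab(2)] by simp
        qed
        have "b \<in> (\<lambda>a. c a n) ` carrier (H m)" if b: "b \<in> carrier (H n)" for b
        proof -
          obtain d where d: "d \<in> supported F" "d n = b"
            using supported_coordinate[OF xF _ b] x by blast
          then show ?thesis
            using c_eq[OF d(1)] D_closed[OF supported_D[OF d(1)]] by (intro image_eqI[of _ _ "d m"]) auto
        qed
        then show "(\<lambda>a. c a n) ` carrier (H m) = carrier (H n)"
          using c D_closed supported_D by blast
      qed
    qed
    then show False using not_iso_H m(2) is_isoI by blast
  qed
  then obtain y where "y \<in> supported {n}" "y n = h"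
    using supported_coordinate[OF xF _ h] x by auto
  then have "y = (\<lambda>i. if i = n then h else \<one>\<^bsub>H i\<^esub>)" by (auto simp: supported_def)
  then show ?thesis using \<open>y \<in> supported {n}\<close> supported_D by blast
qed

lemma sum_subset_D: "carrier (sum_group UNIV H) \<subseteq> D"
proof
  fix x assume "x \<in> carrier (sum_group UNIV H)"
  then have x: "\<And>n. x n \<in> carrier (H n)" and fin: "finite {n. x n \<noteq> \<one>\<^bsub>H n\<^esub>}"
    using carrier_sum_group[of UNIV H] group_H by (auto simp: PiE_iff)
  define y where "y N = (\<lambda>i. if i < N then x i else \<one>\<^bsub>H i\<^esub>)" for N
  have "y N \<in> D" for N
  proof (induction N)
    case 0
    then show ?case using one_D by (simp add: y_def)
  next
    case (Suc N)
    have "y (Suc N) = (\<lambda>i. y N i \<otimes>\<^bsub>H i\<^esub> (if i = N then x N else \<one>\<^bsub>H i\<^esub>))"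
      using x by (auto simp: y_def fun_eq_iff less_Suc_eq)
    then show ?case using mult_D[OF Suc supported_single[OF x]] by simp
  qed
  moreover obtain N where N: "{n. x n \<noteq> \<one>\<^bsub>H n\<^esub>} \<subseteq> {..<N}" using fin finite_nat_iff_bounded by blast
  have "x i = \<one>\<^bsub>H i\<^esub>" if "\<not> i < N" for i
    using N that by blast
  then have "y N = x" by (auto simp: y_def fun_eq_iff)
  ultimately show "x \<in> D" by metis
qed

section \<open>The tail map\<close>

sublocale product_subgroup H D
  by (rule product_subgroup.intro) (rule group_H finite_H subgroup_D sum_subset_D)+

text \<open>Evaluates the definite description once and for all: \<open>ex_follows\<close> and
  \<open>follows_unique\<close> give a map with the required properties, and any other agrees with
  it by induction over the generators.\<close>

lemma tail_map_follows:
  assumes "x \<in> D"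
  shows "follows x (tail_map G S H \<theta> x)"
proof -
  define t where "t = (\<lambda>x\<in>D. THE \<tau>. follows x \<tau>)"
  have t: "follows x (t x)" if "x \<in> D" for x
    using theI'[of "follows x"] ex_follows[OF that] follows_unique that by (auto simp: t_def)
  let ?Q = "\<lambda>t. t \<in> hom (diagonal_product S H \<theta>) G \<inter> extensional (carrier (diagonal_product S H \<theta>)) \<and>
     (\<forall>s\<in>S. t (\<lambda>n. \<theta> n s) = s)"
  have "tail_map G S H \<theta> = t"
    unfolding tail_map_def
  proof (rule the_equality)
    have "t \<in> hom \<Delta> G"
    proof (rule homI)
      show "t x \<in> carrier G" if "x \<in> carrier \<Delta>" for x
        using t[of x] that by (simp add: follows_def)
      show "t (x \<otimes>\<^bsub>\<Delta>\<^esub> y) = t x \<otimes> t y" if "x \<in> carrier \<Delta>" "y \<in> carrier \<Delta>" for x y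
        unfolding mult_\<Delta> using that mult_D
        by (intro follows_unique[OF t follows_mult[OF t t]]) auto
    qed
    moreover have "t (\<lambda>n. \<theta> n s) = s" if "s \<in> S" for s
      by (rule follows_unique[OF t[OF gen_D[OF that]] follows_gen[OF that]])
    ultimately show "?Q t"
      unfolding diagonal_product_eq by (auto simp: t_def)
  next
    fix f assume "?Q f"
    then have f: "f \<in> hom \<Delta> G" "f \<in> extensional D" "\<And>s. s \<in> S \<Longrightarrow> f (\<lambda>n. \<theta> n s) = s"
      unfolding diagonal_product_eq by auto
    interpret f: group_hom \<Delta> G f
      using f(1) group_\<Delta> by (simp add: group_hom_def group_hom_axioms_def group_axioms)
    have "follows x (f x)" if "x \<in> D" for x
      using that
    proof (induction rule: D_induct)
      case one
      show ?case using f.hom_one follows_one unfolding one_\<Delta> by simp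
    next
      case (gen s)
      then show ?case using f(3) follows_gen by simp
    next
      case (inv s)
      have "f (\<lambda>n. inv\<^bsub>H n\<^esub> \<theta> n s) = inv s"
        using f.hom_inv[of "\<lambda>n. \<theta> n s"] gen_D[OF inv] f(3)[OF inv] inv_\<Delta>[OF gen_D[OF inv]] by simp
      then show ?case using follows_inv[OF follows_gen[OF inv]] by simp
    next
      case (mult x y)
      have "f (\<lambda>n. x n \<otimes>\<^bsub>H n\<^esub> y n) = f x \<otimes> f y"
        using f.hom_mult[of x y] mult.hyps unfolding mult_\<Delta> by simp
      then show ?case using follows_mult mult.IH by simp
    qed
    then have "f x = t x" if "x \<in> D" for x
      using follows_unique t that by blast
    then show "f = t"
      using f(2) by (auto simp: t_def extensional_def fun_eq_iff)
  qed
  then show ?thesis using t[OF assms] by simp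
qed

end

section \<open>The reference trace and the classification\<close>

text \<open>Kernels pull back along arbitrary maps, so a set-theoretic section \<open>s\<close> of
  \<open>t\<close> carries positivity from \<open>D\<close> to \<open>G\<close>.\<close>

lemma (in group) trace_descend:
  assumes D: "group D" and t: "t \<in> hom D G" "t ` carrier D = carrier G"
    and \<psi>: "\<psi> \<in> extensional (carrier G)" "(\<lambda>x\<in>carrier D. \<psi> (t x)) \<in> traces D"
  shows "\<psi> \<in> traces G"
proof -
  interpret D: group D by fact
  interpret t: group_hom D G t
    using t(1) D by (simp add: group_hom_def group_hom_axioms_def group_axioms)
  define s where "s = inv_into (carrier D) t"
  have s: "s g \<in> carrier D" "t (s g) = g" if "g \<in> carrier G" for g
    using that t(2) by (auto simp: s_def inv_into_into f_inv_into_f)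
  have pd: "pos_kernel (carrier D) (\<lambda>x y. (\<lambda>x\<in>carrier D. \<psi> (t x)) (inv\<^bsub>D\<^esub> y \<otimes>\<^bsub>D\<^esub> x))"
    using \<psi>(2) by (simp only: traces_iff positive_definite_iff_pos_kernel)
  have "pos_kernel (carrier G) (\<lambda>g h. (\<lambda>x\<in>carrier D. \<psi> (t x)) (inv\<^bsub>D\<^esub> (s h) \<otimes>\<^bsub>D\<^esub> s g))"
    by (rule pos_kernel_pullback[OF pd]) (use s in auto)
  then have "positive_definite G \<psi>"
    unfolding positive_definite_iff_pos_kernel by (subst (asm) pos_kernel_cong) (use s in auto)
  moreover have "\<psi> (x \<otimes> g \<otimes> inv x) = \<psi> g" if "g \<in> carrier G" "x \<in> carrier G" for g x
    using \<psi>(2) conjugation_invariantD[of D "\<lambda>x\<in>carrier D. \<psi> (t x)" "s g" "s x"] s that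
    by (simp add: traces_iff)
  moreover have "\<psi> \<one> = 1"
    using \<psi>(2) by (simp add: traces_iff)
  ultimately show ?thesis
    using \<psi>(1) by (simp add: traces_iff conjugation_invariant_def)
qed

context diagonal_lef
begin

abbreviation t :: "(nat \<Rightarrow> 'b) \<Rightarrow> 'a" where "t \<equiv> tail_map G S H \<theta>"

lemma t_eqI: "x \<in> D \<Longrightarrow> follows x \<tau> \<Longrightarrow> t x = \<tau>"
  using follows_unique tail_map_follows by blast

lemma t_closed: "x \<in> D \<Longrightarrow> t x \<in> carrier G"
  using tail_map_follows follows_closed by blast

lemma t_hom: "t \<in> hom \<Delta> G"
proof (rule homI)
  show "t x \<in> carrier G" if "x \<in> carrier \<Delta>" for x
    using t_closed that by simp
  show "t (x \<otimes>\<^bsub>\<Delta>\<^esub> y) = t x \<otimes> t y" if "x \<in> carrier \<Delta>" "y \<in> carrier \<Delta>" for x y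
    unfolding mult_\<Delta> using that
    by (intro t_eqI follows_mult tail_map_follows mult_D) auto
qed

lemma t_image: "t ` D = carrier G"
proof
  show "t ` D \<subseteq> carrier G" using t_closed by blast
  show "carrier G \<subseteq> t ` D"
  proof
    fix \<tau> assume "\<tau> \<in> carrier G"
    then obtain x where "x \<in> D" "follows x \<tau>" using ex_lift by blast
    then show "\<tau> \<in> t ` D" using t_eqI by blast
  qed
qed

lemma t_tail:
  assumes "x \<in> D"
  shows "t (tail N x) = t x"
proof (rule t_eqI[OF tail_closed[OF assms] follows_cong[OF tail_map_follows[OF assms]]])
  show "\<forall>\<^sub>F n in sequentially. x n = tail N x n"
    using eventually_ge_at_top[of N] by eventually_elim (simp add: tail_def)
qed

lemma t_embed:
  assumes "h \<in> carrier (H n)"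
  shows "t (embed n h) = \<one>"
proof (rule t_eqI[OF embed_closed[OF assms] follows_cong[OF follows_one]])
  show "\<forall>\<^sub>F i in sequentially. \<one>\<^bsub>H i\<^esub> = embed n h i"
    using eventually_gt_at_top[of n] by eventually_elim (simp add: embed_def)
qed

lemma t_eqD:
  assumes "x \<in> D" "y \<in> D" "t x = t y"
  shows "\<exists>N. \<forall>M\<ge>N. tail M x = tail M y"
proof -
  have "\<forall>\<^sub>F n in sequentially. x n = \<theta> n (t x)" "\<forall>\<^sub>F n in sequentially. y n = \<theta> n (t y)"
    using tail_map_follows[OF assms(1)] tail_map_follows[OF assms(2)] by (simp_all only: follows_def)
  then have "\<forall>\<^sub>F n in sequentially. x n = y n"
    by eventually_elim (use assms(3) in simp)
  then obtain N where "\<And>n. n \<ge> N \<Longrightarrow> x n = y n"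
    by (auto simp: eventually_sequentially)
  then have "\<forall>M\<ge>N. tail M x = tail M y"
    by (auto simp: tail_def fun_eq_iff)
  then show ?thesis by blast
qed

text \<open>The partial products of \<open>\<Otimes>\<^sub>n \<phi> n\<close> are traces on the diagonal product, but their phases need not
  converge. A pointwise limit along a subsequence is still a trace, and its modulus does not
  depend on the subsequence. It serves as base point among the traces that extend \<open>\<Otimes>\<^sub>n \<phi> n\<close>.\<close>

lemma ex_reference_trace:
  assumes \<phi>: "\<And>n. \<phi> n \<in> traces (H n)"
  shows "\<exists>\<Phi>\<in>traces \<Delta>. (\<forall>n. coordinate_trace \<Phi> n = \<phi> n) \<and>
    (\<forall>g\<in>D. (\<lambda>N. \<Prod>i<N. cmod (\<phi> i (g i))) \<longlonglongrightarrow> cmod (\<Phi> g))"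
proof -
  define p where "p N g = (\<Prod>i<N. \<phi> i (g i))" for N and g :: "nat \<Rightarrow> 'b"
  have p_trace: "(\<lambda>g\<in>D. p N g) \<in> traces \<Delta>" for N
  proof -
    have "(\<lambda>x. x n) \<in> hom \<Delta> (H n)" for n
      by (rule homI) (simp_all add: D_closed)
    then have coord: "(\<lambda>g\<in>carrier \<Delta>. \<phi> i (g i)) \<in> traces \<Delta>" for i
      by (rule H.trace_pullback[OF \<phi> group_\<Delta>, where \<rho> = "\<lambda>x. x i"])
    have "(\<lambda>g\<in>carrier \<Delta>. \<Prod>i<N. (\<lambda>g\<in>carrier \<Delta>. \<phi> i (g i)) g) \<in> traces \<Delta>"
      by (rule \<Delta>.trace_prod[of "{..<N}" "\<lambda>i. \<lambda>g\<in>carrier \<Delta>. \<phi> i (g i)", OF coord])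
    moreover have "(\<lambda>g\<in>carrier \<Delta>. \<Prod>i<N. (\<lambda>g\<in>carrier \<Delta>. \<phi> i (g i)) g) = (\<lambda>g\<in>D. p N g)"
      by (auto simp: p_def fun_eq_iff)
    ultimately show ?thesis by simp
  qed
  have \<phi>1: "cmod (\<phi> i (g i)) \<le> 1" if "g \<in> D" for g i
    using H.trace_bound[OF \<phi> D_closed[OF that]] .
  have p_bound: "norm (p N g) \<le> 1" if "g \<in> D" for N g
    unfolding p_def prod_norm[symmetric] using \<phi>1[OF that] by (intro prod_le_1) auto
  obtain k where k: "strict_mono (k :: nat \<Rightarrow> nat)"
    and conv: "\<And>g. g \<in> D \<Longrightarrow> \<exists>l. (\<lambda>n. p (k n) g) \<longlonglongrightarrow> l"
    by (rule function_convergent_subsequence[OF countable_D, of p 1]) (use p_bound in auto)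
  define \<Phi> where "\<Phi> = (\<lambda>g\<in>D. lim (\<lambda>n. p (k n) g))"
  have lim: "(\<lambda>n. p (k n) g) \<longlonglongrightarrow> \<Phi> g" if "g \<in> D" for g
    using conv[OF that] that by (simp add: \<Phi>_def convergent_LIMSEQ_iff[symmetric] convergent_def)
  have k_top: "filterlim k at_top sequentially" by (rule filterlim_subseq[OF k])
  have "\<Phi> \<in> traces \<Delta>"
  proof (rule \<Delta>.trace_limit[OF p_trace])
    show "\<Phi> \<in> extensional (carrier \<Delta>)" by (simp add: \<Phi>_def)
    show "(\<lambda>n. restrict (p (k n)) D g) \<longlonglongrightarrow> \<Phi> g" if "g \<in> carrier \<Delta>" for g
      using lim[of g] that by simp
  qed
  moreover have "coordinate_trace \<Phi> n = \<phi> n" for n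
  proof
    fix h
    show "coordinate_trace \<Phi> n h = \<phi> n h"
    proof (cases "h \<in> carrier (H n)")
      case True
      have "p N (embed n h) = \<phi> n h" if "N > n" for N
      proof -
        have "p N (embed n h) = (\<Prod>i<N. if i = n then \<phi> n h else 1)"
          unfolding p_def using \<phi> by (intro prod.cong) (auto simp: embed_def traces_iff)
        then show ?thesis using that by simp
      qed
      moreover have "\<forall>\<^sub>F m in sequentially. k m > n"
        using k_top eventually_gt_at_top[of n] by (auto simp: filterlim_iff)
      ultimately have "\<forall>\<^sub>F m in sequentially. p (k m) (embed n h) = \<phi> n h"
        by (auto elim: eventually_mono)
      then have "(\<lambda>m. p (k m) (embed n h)) \<longlonglongrightarrow> \<phi> n h"
        by (rule tendsto_eventually)
      then have "\<Phi> (embed n h) = \<phi> n h"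
        using LIMSEQ_unique lim[OF embed_closed[OF True]] by blast
      then show ?thesis using True by (simp add: coordinate_trace_def)
    next
      case False
      then show ?thesis
        using \<phi>[of n] by (auto simp: coordinate_trace_def traces_iff extensional_def)
    qed
  qed
  moreover have "(\<lambda>N. \<Prod>i<N. cmod (\<phi> i (g i))) \<longlonglongrightarrow> cmod (\<Phi> g)" if g: "g \<in> D" for g
  proof -
    let ?q = "\<lambda>N. \<Prod>i<N. cmod (\<phi> i (g i))"
    have q0: "?q N \<ge> 0" for N by (intro prod_nonneg) auto
    \<comment> \<open>The moduli decrease, so the whole sequence converges and not just the chosen
      subsequence.\<close>
    have "decseq ?q"
    proof (rule decseq_SucI)
      fix N show "?q (Suc N) \<le> ?q N"
        using mult_left_le[OF \<phi>1[OF g, of N] q0[of N]] by simp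
    qed
    then obtain L where L: "?q \<longlonglongrightarrow> L"
      using decseq_convergent[of ?q 0] q0 by blast
    have "(\<lambda>n. ?q (k n)) \<longlonglongrightarrow> L"
      using LIMSEQ_subseq_LIMSEQ[OF L k] by (simp add: o_def)
    moreover have "(\<lambda>n. ?q (k n)) \<longlonglongrightarrow> cmod (\<Phi> g)"
      using tendsto_norm[OF lim[OF g]] by (simp add: p_def prod_norm)
    ultimately have "L = cmod (\<Phi> g)" by (rule LIMSEQ_unique)
    with L show ?thesis by simp
  qed
  ultimately show ?thesis by blast
qed

text \<open>Chosen as a function of \<open>\<phi>\<close> alone, so that all traces with coordinates
  \<open>\<phi>\<close> share one base point and \<open>combine \<phi>\<close> is affine. Another
  choice may change phases but not moduli, hence not nullity.\<close>

definition reference_trace :: "(nat \<Rightarrow> 'b \<Rightarrow> complex) \<Rightarrow> (nat \<Rightarrow> 'b) \<Rightarrow> complex" where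
  "reference_trace \<phi> = (SOME \<Phi>. \<Phi> \<in> traces \<Delta> \<and> (\<forall>n. coordinate_trace \<Phi> n = \<phi> n) \<and>
    (\<forall>g\<in>D. (\<lambda>N. \<Prod>i<N. cmod (\<phi> i (g i))) \<longlonglongrightarrow> cmod (\<Phi> g)))"

lemma reference_trace:
  assumes "\<And>n. \<phi> n \<in> traces (H n)"
  shows "reference_trace \<phi> \<in> traces \<Delta>"
    and "coordinate_trace (reference_trace \<phi>) n = \<phi> n"
    and "g \<in> D \<Longrightarrow> (\<lambda>N. \<Prod>i<N. cmod (\<phi> i (g i))) \<longlonglongrightarrow> cmod (reference_trace \<phi> g)"
  using someI_ex[OF ex_reference_trace[OF assms, unfolded Bex_def]]
  unfolding reference_trace_def by blast+

lemma null_element_iff: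
  assumes "\<And>n. \<phi> n \<in> traces (H n)"
  shows "null_element G S H \<theta> \<phi> \<tau> \<longleftrightarrow> (\<forall>g\<in>D. t g = \<tau> \<longrightarrow> reference_trace \<phi> g = 0)"
proof -
  have "(\<lambda>N. \<Prod>i<N. cmod (\<phi> i (g i))) \<longlonglongrightarrow> 0 \<longleftrightarrow> reference_trace \<phi> g = 0" if "g \<in> D" for g
    using reference_trace(3)[OF assms that] LIMSEQ_unique by fastforce
  then show ?thesis
    unfolding null_element_def diagonal_product_eq by auto
qed

section \<open>Extensions of the tensor product versus compatible traces\<close>

definition combine :: "(nat \<Rightarrow> 'b \<Rightarrow> complex) \<Rightarrow> ('a \<Rightarrow> complex) \<Rightarrow> (nat \<Rightarrow> 'b) \<Rightarrow> complex" where
  "combine \<phi> \<psi> = (\<lambda>g\<in>D. reference_trace \<phi> g * \<psi> (t g))"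

text \<open>The coordinate subgroups lie in the kernel of \<open>t\<close>, so the factor
  \<open>\<psi> \<circ> t\<close> leaves the coordinates unchanged.\<close>

lemma combine_trace:
  assumes \<phi>: "\<And>n. \<phi> n \<in> traces (H n)" and \<psi>: "\<psi> \<in> traces G"
  shows "combine \<phi> \<psi> \<in> traces \<Delta>" and "coordinate_trace (combine \<phi> \<psi>) = \<phi>"
proof -
  have "(\<lambda>g\<in>carrier \<Delta>. reference_trace \<phi> g * (\<lambda>g\<in>carrier \<Delta>. \<psi> (t g)) g) \<in> traces \<Delta>"
    by (rule \<Delta>.trace_mult[OF reference_trace(1)[OF \<phi>] trace_pullback[OF \<psi> group_\<Delta> t_hom]])
  moreover have "(\<lambda>g\<in>carrier \<Delta>. reference_trace \<phi> g * (\<lambda>g\<in>carrier \<Delta>. \<psi> (t g)) g) = combine \<phi> \<psi>"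
    by (auto simp: combine_def fun_eq_iff)
  ultimately show "combine \<phi> \<psi> \<in> traces \<Delta>" by simp
  show "coordinate_trace (combine \<phi> \<psi>) = \<phi>"
  proof
    fix n
    have "coordinate_trace (combine \<phi> \<psi>) n = coordinate_trace (reference_trace \<phi>) n"
      using \<psi> t_embed embed_closed
      by (auto simp: coordinate_trace_def combine_def traces_iff fun_eq_iff)
    then show "coordinate_trace (combine \<phi> \<psi>) n = \<phi> n"
      by (simp add: reference_trace(2)[OF \<phi>])
  qed
qed

text \<open>Over a non-null element some reference value is nonzero and can be divided by; at a null
  element, where the product carries no information, compatibility fixes the value 0.\<close>

lemma combine_inj:
  assumes \<phi>: "\<And>n. \<phi> n \<in> traces (H n)"
    and \<psi>: "\<psi> \<in> compatible_traces G S H \<theta> \<phi>" "\<psi>' \<in> compatible_traces G S H \<theta> \<phi>"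
    and eq: "combine \<phi> \<psi> = combine \<phi> \<psi>'"
  shows "\<psi> = \<psi>'"
proof
  fix \<tau>
  show "\<psi> \<tau> = \<psi>' \<tau>"
  proof (cases "\<tau> \<in> carrier G")
    case True
    show ?thesis
    proof (cases "null_element G S H \<theta> \<phi> \<tau>")
      case False
      then obtain g where g: "g \<in> D" "t g = \<tau>" "reference_trace \<phi> g \<noteq> 0"
        by (auto simp: null_element_iff[OF \<phi>])
      then show ?thesis using fun_cong[OF eq, of g] by (simp add: combine_def)
    qed (use True \<psi> in \<open>simp add: compatible_traces_def\<close>)
  next
    case False
    then show ?thesis
      using \<psi> by (auto simp: compatible_traces_def traces_iff extensional_def)
  qed
qed

text \<open>The function \<open>\<psi>\<close> is recovered as \<open>\<psi> (t g) = lim\<^sub>N \<zeta> (tail N g) * cnj (\<Phi> (tail N g))\<close> for the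
  reference trace \<open>\<Phi>\<close>, because \<open>\<bar>\<Phi> (tail N g)\<bar>\<close> tends to \<open>1\<close> unless it vanishes identically.\<close>

lemma ex_combine:
  assumes \<zeta>: "\<zeta> \<in> traces \<Delta>" and \<phi>_def: "\<phi> = coordinate_trace \<zeta>"
    and \<phi>: "\<And>n. \<phi> n \<in> characters (H n)"
  shows "\<exists>\<psi>\<in>compatible_traces G S H \<theta> \<phi>. \<zeta> = combine \<phi> \<psi>"
proof -
  define \<Phi> where "\<Phi> = reference_trace \<phi>"
  note \<phi>t = charactersD(1)[OF \<phi>]
  have \<Phi>: "\<Phi> \<in> traces \<Delta>" "\<And>n. coordinate_trace \<Phi> n = \<phi> n"
    and \<Phi>_lim: "\<And>g. g \<in> D \<Longrightarrow> (\<lambda>N. \<Prod>i<N. cmod (\<phi> i (g i))) \<longlonglongrightarrow> cmod (\<Phi> g)"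
    unfolding \<Phi>_def using reference_trace[OF \<phi>t] by blast+
  define p where "p N g = (\<Prod>i<N. \<phi> i (g i))" for N and g :: "nat \<Rightarrow> 'b"
  have p_lim: "(\<lambda>N. cmod (p N g)) \<longlonglongrightarrow> cmod (\<Phi> g)" if "g \<in> D" for g
    using \<Phi>_lim[OF that] by (simp add: p_def prod_norm)
  have \<zeta>_tail: "\<zeta> g = p N g * \<zeta> (tail N g)" if "g \<in> D" for g N
    using trace_tail[OF \<zeta> _ that, of N] \<phi> by (simp add: p_def \<phi>_def)
  have \<Phi>_tail: "\<Phi> g = p N g * \<Phi> (tail N g)" if "g \<in> D" for g N
    using trace_tail[OF \<Phi>(1) _ that, of N] \<phi> \<Phi>(2) by (simp add: p_def)
  \<comment> \<open>Domination makes \<open>\<zeta>\<close> vanish wherever \<open>\<Phi>\<close>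
    does, as a factorization through \<open>\<Phi>\<close> demands.\<close>
  have \<zeta>_le: "cmod (\<zeta> g) \<le> cmod (\<Phi> g)" if g: "g \<in> D" for g
  proof (rule LIMSEQ_le_const[OF p_lim[OF g]], intro exI allI impI)
    fix N :: nat
    have "cmod (\<zeta> (tail N g)) \<le> 1"
      using \<Delta>.trace_bound[OF \<zeta>] tail_closed[OF g] by simp
    then have "cmod (p N g) * cmod (\<zeta> (tail N g)) \<le> cmod (p N g)"
      by (intro mult_left_le) auto
    then show "cmod (\<zeta> g) \<le> cmod (p N g)"
      by (subst \<zeta>_tail[OF g, of N]) (simp add: norm_mult)
  qed
  define a where "a N g = \<zeta> (tail N g) * cnj (\<Phi> (tail N g))" for N g
  have conv: "\<exists>l. (\<lambda>N. a N g) \<longlonglongrightarrow> l \<and> \<zeta> g = \<Phi> g * l \<and> ((\<forall>N. \<Phi> (tail N g) = 0) \<longrightarrow> l = 0)"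
    if g: "g \<in> D" for g
  proof (cases "\<forall>N. \<Phi> (tail N g) = 0")
    case True
    then have "\<Phi> g = 0" using tail_0[of g] by metis
    then show ?thesis
      using True \<zeta>_le[OF g] by (intro exI[of _ 0]) (simp add: a_def)
  next
    case False
    \<comment> \<open>\<open>\<Phi> g\<close> itself may vanish because of finitely many zero
      factors \<open>\<phi> i (g i)\<close>; cutting these off reaches a tail with nonzero
      value.\<close>
    then obtain M where M: "\<Phi> (tail M g) \<noteq> 0" by blast
    define g' where "g' = tail M g"
    have g': "g' \<in> D" using tail_closed[OF g] by (simp add: g'_def)
    define r where "r = \<zeta> g' / \<Phi> g'"
    have p_ne: "p N g' \<noteq> 0" for N using \<Phi>_tail[OF g', of N] M by (auto simp: g'_def)
    \<comment> \<open>Numerator and denominator lose the same factor \<open>p N g'\<close>, so the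
      quotient \<open>r\<close> is the same on every tail.\<close>
    have \<zeta>r: "\<zeta> (tail N g') = r * \<Phi> (tail N g')" for N
      using \<zeta>_tail[OF g', of N] \<Phi>_tail[OF g', of N] M p_ne[of N]
      by (simp add: r_def g'_def[symmetric])
    have "(\<lambda>N. cmod (\<Phi> g') / cmod (p N g')) \<longlonglongrightarrow> cmod (\<Phi> g') / cmod (\<Phi> g')"
      by (intro tendsto_divide tendsto_const p_lim[OF g']) (use M in \<open>simp add: g'_def\<close>)
    moreover have "cmod (\<Phi> g') / cmod (p N g') = cmod (\<Phi> (tail N g'))" for N
    proof -
      have "cmod (\<Phi> g') = cmod (p N g') * cmod (\<Phi> (tail N g'))"
        by (subst \<Phi>_tail[OF g', of N]) (rule norm_mult)
      then show ?thesis using p_ne[of N] by simp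
    qed
    ultimately have "(\<lambda>N. cmod (\<Phi> (tail N g'))) \<longlonglongrightarrow> 1"
      using M by (simp add: g'_def)
    then have "(\<lambda>N. r * complex_of_real ((cmod (\<Phi> (tail N g')))\<^sup>2)) \<longlonglongrightarrow> r * complex_of_real (1\<^sup>2)"
      by (intro tendsto_intros)
    moreover have "r * complex_of_real ((cmod (\<Phi> (tail N g')))\<^sup>2) = a N g'" for N
      by (simp only: a_def \<zeta>r complex_norm_square mult.assoc)
    ultimately have "(\<lambda>N. a N g') \<longlonglongrightarrow> r" by simp
    moreover have "\<forall>\<^sub>F N in sequentially. a N g' = a N g"
      using eventually_ge_at_top[of M]
      by eventually_elim (simp add: a_def g'_def tail_tail max_absorb1)
    ultimately have lim: "(\<lambda>N. a N g) \<longlonglongrightarrow> r" by (rule Lim_transform_eventually)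
    have "\<zeta> g = \<Phi> g * r"
      using \<zeta>_tail[OF g, of M] \<Phi>_tail[OF g, of M] M by (simp add: r_def g'_def)
    with lim show ?thesis using False by blast
  qed
  define L where "L g = lim (\<lambda>N. a N g)" for g
  have L: "(\<lambda>N. a N g) \<longlonglongrightarrow> L g" "\<zeta> g = \<Phi> g * L g" "(\<forall>N. \<Phi> (tail N g) = 0) \<Longrightarrow> L g = 0" if "g \<in> D" for g
    using conv[OF that] limI[of "\<lambda>N. a N g"] by (auto simp: L_def)
  have L_eq: "L g = L h" if gh: "g \<in> D" "h \<in> D" "t g = t h" for g h
  proof -
    obtain N where N: "\<forall>M\<ge>N. tail M g = tail M h" using t_eqD[OF gh] by blast
    have "\<forall>\<^sub>F M in sequentially. a M g = a M h"
      using eventually_ge_at_top[of N] by eventually_elim (use N in \<open>simp add: a_def\<close>)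
    then have "(\<lambda>N. a N h) \<longlonglongrightarrow> L g" by (rule Lim_transform_eventually[OF L(1)[OF gh(1)]])
    then show ?thesis using L(1)[OF gh(2)] LIMSEQ_unique by blast
  qed
  define \<psi> where "\<psi> = (\<lambda>\<tau>\<in>carrier G. L (inv_into D t \<tau>))"
  have \<psi>_t: "\<psi> (t g) = L g" if g: "g \<in> D" for g
  proof -
    have inv: "inv_into D t (t g) \<in> D" "t (inv_into D t (t g)) = t g"
      by (rule inv_into_into[OF imageI[OF g]], rule f_inv_into_f[OF imageI[OF g]])
    have "\<psi> (t g) = L (inv_into D t (t g))"
      using t_closed[OF g] by (simp add: \<psi>_def)
    also have "\<dots> = L g"
      by (rule L_eq[OF inv(1) g inv(2)])
    finally show ?thesis .
  qed
  have "\<psi> \<in> traces G"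
  proof (rule trace_descend[OF group_\<Delta> t_hom])
    show "t ` carrier \<Delta> = carrier G" using t_image by simp
    show "\<psi> \<in> extensional (carrier G)" by (simp add: \<psi>_def)
    have "(\<lambda>g\<in>carrier \<Delta>. a N g) \<in> traces \<Delta>" for N
    proof -
      have "(\<lambda>x\<in>carrier \<Delta>. (\<lambda>g\<in>carrier \<Delta>. \<zeta> g * (\<lambda>g\<in>carrier \<Delta>. cnj (\<Phi> g)) g) (tail N x)) \<in> traces \<Delta>"
        by (rule \<Delta>.trace_pullback[OF \<Delta>.trace_mult[OF \<zeta> \<Delta>.trace_cnj[OF \<Phi>(1)]] group_\<Delta> tail_hom])
      also have "(\<lambda>x\<in>carrier \<Delta>. (\<lambda>g\<in>carrier \<Delta>. \<zeta> g * (\<lambda>g\<in>carrier \<Delta>. cnj (\<Phi> g)) g) (tail N x))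
          = (\<lambda>g\<in>carrier \<Delta>. a N g)"
        by (auto simp: a_def fun_eq_iff tail_closed)
      finally show ?thesis .
    qed
    then show "(\<lambda>x\<in>carrier \<Delta>. \<psi> (t x)) \<in> traces \<Delta>"
      by (rule \<Delta>.trace_limit) (use L(1) in \<open>auto simp: \<psi>_t\<close>)
  qed
  moreover have "\<psi> \<tau> = 0" if \<tau>: "\<tau> \<in> carrier G" "null_element G S H \<theta> \<phi> \<tau>" for \<tau>
  proof -
    obtain g where g: "g \<in> D" "t g = \<tau>" using \<tau>(1) t_image by (metis imageE)
    \<comment> \<open>All tails of \<open>g\<close> lie over the same \<open>\<tau>\<close>, so
      nullity annihilates \<open>\<Phi>\<close> on each of them.\<close>
    have "\<Phi> (tail N g) = 0" for N
      using \<tau>(2) tail_closed[OF g(1)] t_tail[OF g(1)] g(2) by (simp add: null_element_iff[OF \<phi>t] \<Phi>_def)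
    then show ?thesis using L(3)[OF g(1)] \<psi>_t[OF g(1)] g(2) by simp
  qed
  moreover have "\<zeta> = combine \<phi> \<psi>"
  proof
    fix g
    show "\<zeta> g = combine \<phi> \<psi> g"
      using L(2)[of g] \<psi>_t[of g] \<zeta>
      by (cases "g \<in> D") (auto simp: combine_def \<Phi>_def traces_iff extensional_def)
  qed
  ultimately show ?thesis
    by (auto simp: compatible_traces_def)
qed

lemma combine_convex:
  assumes "\<And>\<tau>. \<tau> \<in> carrier G \<Longrightarrow> \<psi> \<tau> = of_real u * \<alpha> \<tau> + of_real (1 - u) * \<beta> \<tau>" "g \<in> D"
  shows "combine \<phi> \<psi> g = of_real u * combine \<phi> \<alpha> g + of_real (1 - u) * combine \<phi> \<beta> g"
  using assms(2) t_closed[OF assms(2)] by (simp add: combine_def assms(1) algebra_simps)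

text \<open>A decomposition on the diagonal product restricts to decompositions of the characters
  \<open>\<phi> n\<close>. So both parts have coordinates \<open>\<phi>\<close> and come from
  compatible traces, where extremality of \<open>\<psi>\<close> applies.\<close>

lemma combine_character:
  assumes \<phi>: "\<And>n. \<phi> n \<in> characters (H n)" and \<psi>: "\<psi> \<in> compatible_characters G S H \<theta> \<phi>"
  shows "combine \<phi> \<psi> \<in> characters \<Delta>"
proof -
  note \<phi>t = charactersD(1)[OF \<phi>]
  have \<psi>c: "\<psi> \<in> compatible_traces G S H \<theta> \<phi>" and \<psi>t: "\<psi> \<in> traces G"
    using \<psi> by (auto simp: compatible_characters_def extreme_functions_def compatible_traces_def)
  have "\<alpha> = \<beta>" if \<alpha>: "\<alpha> \<in> traces \<Delta>" and \<beta>: "\<beta> \<in> traces \<Delta>" and u: "0 < u" "u < 1"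
    and eq: "\<And>g. g \<in> carrier \<Delta> \<Longrightarrow> combine \<phi> \<psi> g = of_real u * \<alpha> g + of_real (1 - u) * \<beta> g" for \<alpha> \<beta> u
  proof -
    have co: "coordinate_trace \<alpha> n = \<phi> n \<and> coordinate_trace \<beta> n = \<phi> n" for n
    proof -
      have ceq: "\<phi> n h = of_real u * coordinate_trace \<alpha> n h + of_real (1 - u) * coordinate_trace \<beta> n h"
        if "h \<in> carrier (H n)" for h
      proof -
        have "\<phi> n h = combine \<phi> \<psi> (embed n h)"
          by (subst combine_trace(2)[OF \<phi>t \<psi>t, symmetric]) (simp add: coordinate_trace_def that)
        then show ?thesis
          using eq[of "embed n h"] embed_closed[OF that] that by (simp add: coordinate_trace_def)
      qed
      have ab: "coordinate_trace \<alpha> n = coordinate_trace \<beta> n"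
        by (rule charactersD(2)[OF \<phi> coordinate_trace_trace[OF \<alpha>] coordinate_trace_trace[OF \<beta>] u ceq])
      have "coordinate_trace \<beta> n h = \<phi> n h" for h
      proof (cases "h \<in> carrier (H n)")
        case True
        then show ?thesis using ceq[OF True] unfolding ab by (simp add: algebra_simps)
      next
        case False
        then show ?thesis
          using \<phi>t[of n] by (auto simp: coordinate_trace_def traces_iff extensional_def)
      qed
      then have "coordinate_trace \<beta> n = \<phi> n" by (rule ext)
      with ab show ?thesis by simp
    qed
    then have "\<phi> = coordinate_trace \<alpha>" "\<phi> = coordinate_trace \<beta>" by (auto simp: fun_eq_iff)
    then obtain \<alpha>' \<beta>' where \<alpha>': "\<alpha>' \<in> compatible_traces G S H \<theta> \<phi>" "\<alpha> = combine \<phi> \<alpha>'"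
      and \<beta>': "\<beta>' \<in> compatible_traces G S H \<theta> \<phi>" "\<beta> = combine \<phi> \<beta>'"
      using ex_combine[OF \<alpha> _ \<phi>] ex_combine[OF \<beta> _ \<phi>] by blast
    \<comment> \<open>At null elements the product says nothing about \<open>\<psi>\<close>, but
      there all three traces vanish.\<close>
    have "\<psi> \<tau> = of_real u * \<alpha>' \<tau> + of_real (1 - u) * \<beta>' \<tau>" if \<tau>: "\<tau> \<in> carrier G" for \<tau>
    proof (cases "null_element G S H \<theta> \<phi> \<tau>")
      case True
      then show ?thesis using \<psi>c \<alpha>' \<beta>' \<tau> by (simp add: compatible_traces_def)
    next
      case False
      then obtain g where g: "g \<in> D" "t g = \<tau>" "reference_trace \<phi> g \<noteq> 0"
        by (auto simp: null_element_iff[OF \<phi>t])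
      have "reference_trace \<phi> g * \<psi> \<tau>
          = reference_trace \<phi> g * (of_real u * \<alpha>' \<tau> + of_real (1 - u) * \<beta>' \<tau>)"
        using eq[of g] g unfolding \<alpha>' \<beta>' by (simp add: combine_def algebra_simps)
      then show ?thesis using g(3) by simp
    qed
    then have "\<alpha>' = \<beta>'"
      using \<psi> \<alpha>'(1) \<beta>'(1) u unfolding compatible_characters_def extreme_functions_def by blast
    then show ?thesis using \<alpha>' \<beta>' by simp
  qed
  then show ?thesis
    using combine_trace(1)[OF \<phi>t \<psi>t] unfolding characters_def extreme_functions_def by blast
qed

text \<open>\<open>combine \<phi>\<close> is affine, and injective on compatible traces, so a proper
  decomposition of \<open>\<psi>\<close> would push forward to one of
  \<open>\<zeta>\<close>.\<close>

lemma character_combine: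
  assumes \<zeta>: "\<zeta> \<in> characters \<Delta>"
  shows "\<exists>\<psi>\<in>compatible_characters G S H \<theta> (coordinate_trace \<zeta>). \<zeta> = combine (coordinate_trace \<zeta>) \<psi>"
proof -
  define \<phi> where "\<phi> = coordinate_trace \<zeta>"
  have \<phi>: "\<phi> n \<in> characters (H n)" for n
    unfolding \<phi>_def by (rule coordinate_trace_character[OF \<zeta>])
  note \<phi>t = charactersD(1)[OF \<phi>]
  obtain \<psi> where \<psi>: "\<psi> \<in> compatible_traces G S H \<theta> \<phi>" "\<zeta> = combine \<phi> \<psi>"
    using ex_combine[OF charactersD(1)[OF \<zeta>] \<phi>_def \<phi>] by blast
  have "\<alpha> = \<beta>" if \<alpha>: "\<alpha> \<in> compatible_traces G S H \<theta> \<phi>" and \<beta>: "\<beta> \<in> compatible_traces G S H \<theta> \<phi>"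
    and u: "0 < u" "u < 1"
    and eq: "\<And>\<tau>. \<tau> \<in> carrier G \<Longrightarrow> \<psi> \<tau> = of_real u * \<alpha> \<tau> + of_real (1 - u) * \<beta> \<tau>" for \<alpha> \<beta> u
  proof -
    have "\<alpha> \<in> traces G" "\<beta> \<in> traces G" using \<alpha> \<beta> by (auto simp: compatible_traces_def)
    then have "combine \<phi> \<alpha> = combine \<phi> \<beta>"
      using combine_convex[OF eq] \<psi>(2)
      by (intro charactersD(2)[OF \<zeta> combine_trace(1)[OF \<phi>t] combine_trace(1)[OF \<phi>t] u]) auto
    then show ?thesis by (rule combine_inj[OF \<phi>t \<alpha> \<beta>])
  qed
  then have "\<psi> \<in> compatible_characters G S H \<theta> \<phi>"
    using \<psi>(1) unfolding compatible_characters_def extreme_functions_def by blast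
  then show ?thesis using \<psi>(2) unfolding \<phi>_def by blast
qed

lemma bij_betw_combine:
  "bij_betw (\<lambda>(\<phi>, \<psi>). combine \<phi> \<psi>)
     {(\<phi>, \<psi>). (\<forall>n. \<phi> n \<in> characters (H n)) \<and> \<psi> \<in> compatible_characters G S H \<theta> \<phi>} (characters \<Delta>)"
proof (rule bij_betw_imageI)
  let ?X = "{(\<phi>, \<psi>). (\<forall>n. \<phi> n \<in> characters (H n)) \<and> \<psi> \<in> compatible_characters G S H \<theta> \<phi>}"
  have compat: "\<psi> \<in> compatible_traces G S H \<theta> \<phi>" "\<psi> \<in> traces G"
    if "\<psi> \<in> compatible_characters G S H \<theta> \<phi>" for \<phi> \<psi>
    using that by (auto simp: compatible_characters_def extreme_functions_def compatible_traces_def)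
  show "inj_on (\<lambda>(\<phi>, \<psi>). combine \<phi> \<psi>) ?X"
  proof (rule inj_onI, clarify)
    fix \<phi> \<psi> \<phi>' \<psi>'
    assume \<phi>: "\<forall>n. \<phi> n \<in> characters (H n)" and \<psi>: "\<psi> \<in> compatible_characters G S H \<theta> \<phi>"
      and \<phi>': "\<forall>n. \<phi>' n \<in> characters (H n)" and \<psi>': "\<psi>' \<in> compatible_characters G S H \<theta> \<phi>'"
      and eq: "combine \<phi> \<psi> = combine \<phi>' \<psi>'"
    have \<phi>t: "\<phi> n \<in> traces (H n)" "\<phi>' n \<in> traces (H n)" for n
      using \<phi> \<phi>' charactersD(1) by blast+
    have "\<phi> = \<phi>'"
      using combine_trace(2)[OF \<phi>t(1) compat(2)[OF \<psi>]] combine_trace(2)[OF \<phi>t(2) compat(2)[OF \<psi>']] eq by simp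
    moreover from this have "\<psi> = \<psi>'"
      using combine_inj[OF \<phi>t(1) compat(1)[OF \<psi>]] compat(1)[OF \<psi>'] eq by blast
    ultimately show "\<phi> = \<phi>' \<and> \<psi> = \<psi>'" by blast
  qed
  show "(\<lambda>(\<phi>, \<psi>). combine \<phi> \<psi>) ` ?X = characters \<Delta>"
  proof
    show "(\<lambda>(\<phi>, \<psi>). combine \<phi> \<psi>) ` ?X \<subseteq> characters \<Delta>"
    proof (rule image_subsetI, clarify)
      fix \<phi> \<psi>
      assume "\<forall>n. \<phi> n \<in> characters (H n)" "\<psi> \<in> compatible_characters G S H \<theta> \<phi>"
      then show "combine \<phi> \<psi> \<in> characters \<Delta>" by (intro combine_character) auto
    qed
    show "characters \<Delta> \<subseteq> (\<lambda>(\<phi>, \<psi>). combine \<phi> \<psi>) ` ?X"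
    proof
      fix \<zeta> assume \<zeta>: "\<zeta> \<in> characters \<Delta>"
      obtain \<psi> where \<psi>: "\<psi> \<in> compatible_characters G S H \<theta> (coordinate_trace \<zeta>)"
        and eq: "\<zeta> = combine (coordinate_trace \<zeta>) \<psi>"
        using character_combine[OF \<zeta>] by blast
      show "\<zeta> \<in> (\<lambda>(\<phi>, \<psi>). combine \<phi> \<psi>) ` ?X"
      proof (rule image_eqI)
        show "\<zeta> = (\<lambda>(\<phi>, \<psi>). combine \<phi> \<psi>) (coordinate_trace \<zeta>, \<psi>)"
          unfolding prod.case by (rule eq)
        show "(coordinate_trace \<zeta>, \<psi>) \<in> ?X"
          using \<psi> coordinate_trace_character[OF \<zeta>] by simp
      qed
    qed
  qed
qed

lemma restrict_eq_tensor_character: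
  assumes \<zeta>: "\<zeta> \<in> characters \<Delta>"
  shows "restrict \<zeta> (carrier (sum_group UNIV H)) = tensor_character H (coordinate_trace \<zeta>)"
proof
  fix g
  show "restrict \<zeta> (carrier (sum_group UNIV H)) g = tensor_character H (coordinate_trace \<zeta>) g"
    using trace_sum_group[OF charactersD(1)[OF \<zeta>] coordinate_trace_character[OF \<zeta>], of g]
    by (cases "g \<in> carrier (sum_group UNIV H)") (simp_all add: tensor_character_def)
qed

end

theorem theorem1p7:
  fixes G :: "('a, 'm) monoid_scheme"
    and S :: "'a set"
    and H :: "nat \<Rightarrow> ('b, 'k) monoid_scheme"
    and \<theta> :: "nat \<Rightarrow> 'a \<Rightarrow> 'b"
  assumes "group G"
    and "finite S" and "S \<subseteq> carrier G" and "generate G S = carrier G"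
    and "lef_approximation G H \<theta>"
    and "essential_by_simple_groups G S H \<theta>"
  shows "\<exists>\<Phi>. bij_betw \<Phi> (characters (diagonal_product S H \<theta>))
             {(\<phi>, \<psi>). (\<forall>n. \<phi> n \<in> characters (H n)) \<and> \<psi> \<in> compatible_characters G S H \<theta> \<phi>} \<and>
           (\<forall>\<zeta> \<in> characters (diagonal_product S H \<theta>).
              restrict \<zeta> (carrier (sum_group UNIV H)) \<in> characters (sum_group UNIV H) \<and>
              restrict \<zeta> (carrier (sum_group UNIV H)) = tensor_character H (fst (\<Phi> \<zeta>)))"
proof -
  interpret group G by fact
  interpret diagonal_lef G S H \<theta>
    by unfold_locales (rule assms)+
  let ?X = "{(\<phi>, \<psi>). (\<forall>n. \<phi> n \<in> characters (H n)) \<and> \<psi> \<in> compatible_characters G S H \<theta> \<phi>}"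
  let ?\<Psi> = "\<lambda>(\<phi>, \<psi>). combine \<phi> \<psi>"
  \<comment> \<open>The explicit map starts from pairs; the first component of its inverse is read
    off at a known preimage.\<close>
  let ?\<Phi> = "inv_into ?X ?\<Psi>"
  have "fst (?\<Phi> \<zeta>) = coordinate_trace \<zeta>" if \<zeta>: "\<zeta> \<in> characters \<Delta>" for \<zeta>
  proof -
    obtain \<psi> where \<psi>: "\<psi> \<in> compatible_characters G S H \<theta> (coordinate_trace \<zeta>)"
      and eq: "\<zeta> = combine (coordinate_trace \<zeta>) \<psi>"
      using character_combine[OF \<zeta>] by blast
    have "?\<Phi> (?\<Psi> (coordinate_trace \<zeta>, \<psi>)) = (coordinate_trace \<zeta>, \<psi>)"
      by (rule inv_into_f_f[OF bij_betw_imp_inj_on[OF bij_betw_combine]])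
         (use \<psi> coordinate_trace_character[OF \<zeta>] in auto)
    then have "?\<Phi> \<zeta> = (coordinate_trace \<zeta>, \<psi>)"
      by (simp only: prod.case eq[symmetric])
    then show ?thesis by simp
  qed
  then show ?thesis
    unfolding diagonal_product_eq
    using bij_betw_inv_into[OF bij_betw_combine] restrict_sum_group_character restrict_eq_tensor_character
    by (intro exI[of _ ?\<Phi>]) simp
qed

end
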